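(* For a prime $p$, let $J(p;1)$ be the number of solutions of the congruence $$x^{x}\equiv 1\pmod p,\qquad x\in\mathbb{N},\quad x\le p-1.$$ Then $J(p;1)\lesssim p^{27/82}$; that is, for every $\varepsilon>0$ there exists a constant $c=c(\varepsilon)>0$ such that for every prime $p$ one has $J(p;1)<c\,p^{27/82+\varepsilon}$.
   Context: $\mathbb{N}$ denotes the set of positive integers. The notation $A\lesssim B$ means $A<Bp^{o(1)}$; that is, for any $\varepsilon>0$ there exists $c=c(\varepsilon)>0$ such that $A<cBp^{\varepsilon}$. *)

theory Defs
  imports Complex_Main "HOL-Number_Theory.Number_Theory"
begin

definition J :: "nat \<Rightarrow> nat \<Rightarrow> nat" where
  "J p a = card {x::nat. 1 \<le> x \<and> x \<le> p - 1 \<and> [x ^ x = a] (mod p)}"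

end

(* J(p;1) is at most the sum over d | p - 1 of the number M of x <= p - 1 with ord x = d and d | x.
   Writing x = d y gives M integers y <= p/d in one coset of the group G of order d.  If k such y are
   multiplied, the product lies in a coset of G and has p^o(1) factorisations, so
   M^k <= p^o(1) d ((p/d)^k / p + 1); together with M <= min(d, p/d), the cases k = 2, 3 suffice unless
   p^(27/82) < d < p^(28/82).  There a Fejer kernel bounds M by the average of |S(a r)| over 0 < r < d,
   where S is the exponential sum over G.  S is constant on cosets and by the case k = 3 a coset
   contains at most p^(10/82 + o(1)) of these r, so the fourth moment of S, that is the additive energy
   of G, controls the average.  The energy is at most d^(5/2 + o(1)) by Stepanov's method in the form of
   Heath-Brown and Konyagin, and M <= p^(106/328 + o(1)) follows, where 106/328 < 27/82. *)

theory Submission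
  imports Defs "HOL-Library.FuncSet" "HOL-Library.Real_Mod" "HOL-Computational_Algebra.Polynomial"
    "HOL-Analysis.Harmonic_Numbers"
begin

section \<open>Integer polynomials modulo a prime\<close>

text \<open>The bounds M <= d and M^2 <= p^o(1) (p/d + d) meet at d = p^(1/3) and give no more than
  p^(1/3) there, so any exponent below 1/3 needs further input for d near p^(1/3). Demanding 27/82
  fixes the window: it opens where M <= d stops sufficing and closes at p^(28/82), where (p/d)^(1/2)
  has come down to p^(27/82). It lies below p^(1/2), the range in which Stepanov's method is
  applied. The saving in the energy is essential: the trivial bound d^3 would lead to the exponent
  120/328 at the upper end of the window, worse than 1/3.

  The prime is a variable, so polynomials stay over the integers: being zero modulo p is
  divisibility by the constant polynomial \<open>[:p:]\<close>, multiplicity is read off derivatives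
  modulo p, and linear systems modulo p are solved by pigeonhole. Auxiliary polynomials are
  differentiated by operators q d/dX, with q chosen so that their special shape is preserved; a
  triangular change of basis leads back to ordinary derivatives.\<close>

lemma higher_pderiv_linear_mult:
  "(pderiv ^^ Suc n) ([:- x, 1:] * g) =
     [:- x, 1:] * (pderiv ^^ Suc n) g + of_nat (Suc n) * (pderiv ^^ n) (g :: int poly)"
proof (induction n)
  case 0
  then show ?case by (simp add: pderiv_diff pderiv_pCons pderiv_smult)
next
  case (Suc n)
  have "(pderiv ^^ Suc (Suc n)) ([:- x, 1:] * g) = pderiv ((pderiv ^^ Suc n) ([:- x, 1:] * g))"
    by simp
  also have "\<dots> = pderiv ([:- x, 1:] * (pderiv ^^ Suc n) g + of_nat (Suc n) * (pderiv ^^ n) g)"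
    by (simp only: Suc)
  also have "\<dots> = [:- x, 1:] * (pderiv ^^ Suc (Suc n)) g + of_nat (Suc (Suc n)) * (pderiv ^^ Suc n) g"
  proof -
    have 1: "pderiv (of_nat m :: int poly) = 0" for m
      by (induction m) (auto simp: pderiv_add)
    have 2: "pderiv [:- x, 1:] = (1 :: int poly)"
      by (simp add: pderiv_pCons)
    show ?thesis
      by (simp only: pderiv_add pderiv_mult 1 2 funpow.simps o_apply) (simp add: algebra_simps)
  qed
  finally show ?case .
qed

text \<open>Induction on the total multiplicity: dividing f by X - x lowers the demand at x by one
  and leaves a remainder divisible by p. At x the Leibniz rule produces a factor n + 1, invertible
  because n + 1 < m x <= p; at any other y the factor y - x is invertible, so the order at y carries
  over to the quotient.\<close>

lemma sum_root_multiplicities_mod_le_degree: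
  fixes p :: int and f :: "int poly" and m :: "int \<Rightarrow> nat"
  assumes p: "prime p" and "\<not> [:p:] dvd f" and S: "finite S"
    and inc: "\<And>x y. x \<in> S \<Longrightarrow> y \<in> S \<Longrightarrow> p dvd x - y \<Longrightarrow> x = y"
    and "\<And>x n. x \<in> S \<Longrightarrow> n < m x \<Longrightarrow> p dvd poly ((pderiv ^^ n) f) x"
    and "\<And>x. x \<in> S \<Longrightarrow> int (m x) \<le> p"
  shows "sum m S \<le> degree f"
  using assms(2,5,6)
proof (induction "sum m S" arbitrary: f m)
  case 0
  then show ?case by simp
next
  case (Suc N)
  then obtain x where x: "x \<in> S" "m x > 0"
    by (metis Suc_neq_Zero gr0I sum.neutral)
  define g where "g = synthetic_div f x"
  define r where "r = poly f x"
  have fg: "f = [:- x, 1:] * g + [:r:]"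
    using synthetic_div_correct'[of x f] by (simp add: g_def r_def)
  have r: "p dvd r"
    using Suc.prems(2)[of x 0] x by (simp add: r_def)
  have deg0: "degree f \<noteq> 0"
  proof
    assume "degree f = 0"
    then obtain a where "f = [:a:]" by (rule degree_eq_zeroE)
    then show False
      using r Suc.prems(1) by (simp add: r_def)
  qed
  have ng: "\<not> [:p:] dvd g"
  proof
    assume "[:p:] dvd g"
    moreover have "[:p:] dvd [:r:]" using r by simp
    ultimately have "[:p:] dvd f"
      unfolding fg by (metis dvd_add dvd_mult)
    with Suc.prems(1) show False ..
  qed
  define m' where "m' = m(x := m x - 1)"
  have sm: "sum m S = m x + sum m (S - {x})" "sum m' S = m' x + sum m' (S - {x})"
    using x S by (auto simp: sum.remove)
  have sm': "sum m' (S - {x}) = sum m (S - {x})"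
    by (intro sum.cong) (auto simp: m'_def)
  have N: "N = sum m' S"
    using sm sm' Suc.hyps(2) x by (simp add: m'_def)
  have D: "poly ((pderiv ^^ Suc n) f) y =
      (y - x) * poly ((pderiv ^^ Suc n) g) y + int (Suc n) * poly ((pderiv ^^ n) g) y" for n y
  proof -
    have c: "(pderiv ^^ Suc n) [:r:] = 0"
      by (induction n) (auto simp: pderiv_pCons)
    have "(pderiv ^^ Suc n) f = [:- x, 1:] * (pderiv ^^ Suc n) g + of_nat (Suc n) * (pderiv ^^ n) g"
      unfolding fg higher_pderiv_add c higher_pderiv_linear_mult by simp
    then have "poly ((pderiv ^^ Suc n) f) y =
        poly ([:- x, 1:] * (pderiv ^^ Suc n) g + of_nat (Suc n) * (pderiv ^^ n) g) y"
      by (rule arg_cong)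
    then show ?thesis
      by (simp only: poly_add poly_mult of_nat_poly) (simp add: algebra_simps del: funpow.simps)
  qed
  have van: "p dvd poly ((pderiv ^^ n) g) y" if y: "y \<in> S" "n < m' y" for y n
  proof (cases "y = x")
    case True
    then have n: "Suc n < m x" using that by (simp add: m'_def)
    have "p dvd int (Suc n) * poly ((pderiv ^^ n) g) x"
      using Suc.prems(2)[OF x(1) n] D[of n x] by simp
    moreover have "\<not> p dvd int (Suc n)"
      using n Suc.prems(3)[OF x(1)] zdvd_not_zless[of "int (Suc n)" p] by simp
    ultimately show ?thesis
      using p True by (simp add: prime_dvd_mult_iff)
  next
    case False
    then have ny: "\<not> p dvd y - x"
      using inc x y by blast
    have "n < m y" using False that by (simp add: m'_def)
    then show ?thesis
    proof (induction n)
      case 0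
      have "p dvd (y - x) * poly g y + r"
        using Suc.prems(2)[OF y(1), of 0] 0 by (simp add: fg algebra_simps)
      then have "p dvd (y - x) * poly g y" using r by (simp add: dvd_add_left_iff)
      then show ?case using ny p by (simp add: prime_dvd_mult_iff)
    next
      case (Suc n)
      have "p dvd (y - x) * poly ((pderiv ^^ Suc n) g) y + int (Suc n) * poly ((pderiv ^^ n) g) y"
        using Suc.prems Suc.prems(1) \<open>\<And>x n. x \<in> S \<Longrightarrow> n < m x \<Longrightarrow> p dvd poly ((pderiv ^^ n) f) x\<close>[OF y(1), of "Suc n"] D[of n y] by simp
      moreover have "p dvd int (Suc n) * poly ((pderiv ^^ n) g) y"
        using Suc by simp
      ultimately have "p dvd (y - x) * poly ((pderiv ^^ Suc n) g) y"
        using dvd_add_left_iff by blast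
      then show ?case using ny p by (simp add: prime_dvd_mult_iff)
    qed
  qed
  have "sum m' S \<le> degree g"
  proof (rule Suc.hyps(1))
    show "N = sum m' S" by (fact N)
    show "int (m' y) \<le> p" if "y \<in> S" for y
      using Suc.prems(3)[OF that] by (auto simp: m'_def)
  qed (use ng van in auto)
  moreover have "degree g = degree f - 1"
    by (simp add: g_def degree_synthetic_div)
  ultimately show ?case
    using deg0 N Suc.hyps(2) by linarith
qed

text \<open>The derivation q d/dX. With q = X monomials are eigenvectors; with q = X (X - 1)
  products of powers of X and X - 1 are reproduced up to a cofactor of small degree.\<close>

definition deriv_by :: "int poly \<Rightarrow> int poly \<Rightarrow> int poly" where
  "deriv_by q f = q * pderiv f"

lemma deriv_by_add: "deriv_by q (f + g) = deriv_by q f + deriv_by q g"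
  by (simp add: deriv_by_def pderiv_add algebra_simps)

lemma deriv_by_mult: "deriv_by q (f * g) = deriv_by q f * g + f * deriv_by q g"
  by (simp add: deriv_by_def pderiv_mult algebra_simps)

lemma deriv_by_smult: "deriv_by q (smult c f) = smult c (deriv_by q f)"
  by (simp add: deriv_by_def pderiv_smult)

lemma deriv_by_0 [simp]: "deriv_by q 0 = 0"
  by (simp add: deriv_by_def)

lemma deriv_by_iter_add: "(deriv_by q ^^ n) (f + g) = (deriv_by q ^^ n) f + (deriv_by q ^^ n) g"
  by (induction n) (auto simp: deriv_by_add)

lemma deriv_by_iter_smult: "(deriv_by q ^^ n) (smult c f) = smult c ((deriv_by q ^^ n) f)"
  by (induction n) (auto simp: deriv_by_smult)

lemma deriv_by_iter_sum: "(deriv_by q ^^ n) (sum f I) = (\<Sum>i\<in>I. (deriv_by q ^^ n) (f i))"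
proof -
  have "(deriv_by q ^^ n) 0 = 0" by (induction n) auto
  then show ?thesis
    by (induction I rule: infinite_finite_induct) (auto simp: deriv_by_iter_add)
qed

lemma deriv_by_power: "deriv_by q (l ^ n) = of_nat n * l ^ (n - 1) * deriv_by q l"
  by (simp add: deriv_by_def pderiv_power of_nat_poly algebra_simps)

text \<open>The passage from ordinary derivatives to iterates of q d/dX is triangular with diagonal
  entries q^n, hence invertible at points where q is a unit modulo p. The lower coefficients can
  stay anonymous.\<close>

lemma deriv_by_iter_expansion:
  "\<exists>C. (deriv_by q ^^ n) f = q ^ n * (pderiv ^^ n) f + (\<Sum>k<n. C k * (pderiv ^^ k) f)"
proof (induction n)
  case 0
  then show ?case by simp
next
  case (Suc n)
  then obtain C where C: "(deriv_by q ^^ n) f = q ^ n * (pderiv ^^ n) f + (\<Sum>k<n. C k * (pderiv ^^ k) f)"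
    by blast
  let ?F = "\<lambda>k. (pderiv ^^ k) f"
  let ?C = "\<lambda>k. (if k = n then q * pderiv (q ^ n) else q * pderiv (C k)) +
                 (if k = 0 then 0 else q * C (k - 1))"
  have pd: "pderiv (\<Sum>k<n. g k) = (\<Sum>k<n. pderiv (g k))" for g :: "nat \<Rightarrow> int poly"
    by (induction n) (auto simp: pderiv_add)
  have "(deriv_by q ^^ Suc n) f = q * pderiv (q ^ n * ?F n + (\<Sum>k<n. C k * ?F k))"
    by (simp add: C) (simp add: deriv_by_def)
  also have "\<dots> = q ^ Suc n * ?F (Suc n) + q * pderiv (q ^ n) * ?F n +
      ((\<Sum>k<n. q * pderiv (C k) * ?F k) + (\<Sum>k<n. q * C k * ?F (Suc k)))"
    by (simp add: pderiv_add pderiv_mult pd sum_distrib_left sum.distrib algebra_simps)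
  also have "(\<Sum>k<n. q * C k * ?F (Suc k)) = (\<Sum>k<Suc n. (if k = 0 then 0 else q * C (k - 1)) * ?F k)"
    by (subst sum.lessThan_Suc_shift) simp
  also have "q ^ Suc n * ?F (Suc n) + q * pderiv (q ^ n) * ?F n +
      ((\<Sum>k<n. q * pderiv (C k) * ?F k) + (\<Sum>k<Suc n. (if k = 0 then 0 else q * C (k - 1)) * ?F k)) =
      q ^ Suc n * ?F (Suc n) + (\<Sum>k<Suc n. ?C k * ?F k)"
    by (simp add: algebra_simps sum.distrib)
  finally show ?case by (intro exI[of _ ?C]) simp
qed

text \<open>Forward substitution in the triangular system: the lower derivatives vanish by
  induction, and the diagonal entry q^n is cancelled.\<close>

lemma pderiv_iter_dvd_if_deriv_by_iter_dvd:
  fixes p :: int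
  assumes p: "prime p" and q: "\<not> p dvd poly q x"
    and "\<And>n. n < D \<Longrightarrow> p dvd poly ((deriv_by q ^^ n) f) x"
  shows "n < D \<Longrightarrow> p dvd poly ((pderiv ^^ n) f) x"
proof (induction n rule: less_induct)
  case (less n)
  obtain C where C: "(deriv_by q ^^ n) f = q ^ n * (pderiv ^^ n) f + (\<Sum>k<n. C k * (pderiv ^^ k) f)"
    using deriv_by_iter_expansion by blast
  have "p dvd poly (q ^ n * (pderiv ^^ n) f) x + (\<Sum>k<n. poly (C k * (pderiv ^^ k) f) x)"
    using assms(3)[OF less.prems] unfolding C by (simp add: poly_sum)
  moreover have "p dvd (\<Sum>k<n. poly (C k * (pderiv ^^ k) f) x)"
    using less by (intro dvd_sum) auto
  ultimately have "p dvd poly (q ^ n * (pderiv ^^ n) f) x"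
    using dvd_add_left_iff by blast
  then show ?case
    using q p prime_dvd_power by (auto simp: prime_dvd_mult_iff poly_power)
qed

text \<open>Each application consumes at most one factor l. With l = X - 1 this makes a multiple of
  (X - 1)^t vanish at 1 through fewer than t iterations.\<close>

lemma deriv_by_iter_power_mult:
  "\<exists>h. (deriv_by q ^^ j) (l ^ (j + i) * g) = l ^ i * h"
proof (induction j arbitrary: i)
  case 0
  then show ?case by auto
next
  case (Suc j)
  obtain h where h: "(deriv_by q ^^ j) (l ^ (j + Suc i) * g) = l ^ Suc i * h"
    using Suc by blast
  have "(deriv_by q ^^ Suc j) (l ^ (Suc j + i) * g) = deriv_by q (l ^ Suc i * h)"
    using h by simp
  also have "\<dots> = l ^ i * (of_nat (Suc i) * deriv_by q l * h + l * deriv_by q h)"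
    unfolding deriv_by_mult deriv_by_power by (simp add: algebra_simps)
  finally show ?case by blast
qed

text \<open>A lacunary polynomial of degree below \<open>p\<close> cannot vanish at 1 modulo \<open>p\<close> to an order that
  reaches its number of terms: the iterates of \<open>X d/dX\<close> at 1 are power sums of the exponents.\<close>

lemma lacunary_not_dvd_power:
  fixes p :: int and c :: "'k \<Rightarrow> int" and h :: "'k \<Rightarrow> nat"
  assumes p: "prime p" and K: "finite K" and inj: "inj_on h K"
    and hp: "\<And>k. k \<in> K \<Longrightarrow> int (h k) < p"
    and le: "card K \<le> t"
    and dvd: "[:p:] dvd (\<Sum>k\<in>K. monom (c k) (h k)) + [:- 1, 1:] ^ t * g"
    and k: "k \<in> K"
  shows "p dvd c k"
proof -
  let ?X = "[:0, 1:] :: int poly"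
  let ?f = "\<Sum>k\<in>K. monom (c k) (h k)"
  have mon: "(deriv_by ?X ^^ j) (monom a e) = monom (a * int e ^ j) e" for j a e
  proof (induction j)
    case 0
    then show ?case by simp
  next
    case (Suc j)
    have "deriv_by ?X (monom b e) = monom (b * int e) e" for b
      by (cases e) (auto simp: deriv_by_def pderiv_monom monom_Suc[symmetric] mult.commute)
    then show ?case using Suc by (simp add: mult.assoc mult.commute)
  qed
  have pow: "p dvd (\<Sum>k\<in>K. c k * int (h k) ^ j)" if j: "j < t" for j
  proof -
    obtain u where u: "?f + [:- 1, 1:] ^ t * g = smult p u"
      using dvd by (auto simp: dvd_def)
    obtain v where v: "(deriv_by ?X ^^ j) ([:- 1, 1:] ^ (j + (t - j)) * g) = [:- 1, 1:] ^ (t - j) * v"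
      using deriv_by_iter_power_mult by blast
    have "(deriv_by ?X ^^ j) ?f + [:- 1, 1:] ^ (t - j) * v = smult p ((deriv_by ?X ^^ j) u)"
      using arg_cong[OF u, of "deriv_by ?X ^^ j"] v j
      by (simp add: deriv_by_iter_add deriv_by_iter_smult)
    then have "poly ((deriv_by ?X ^^ j) ?f + [:- 1, 1:] ^ (t - j) * v) 1 =
        poly (smult p ((deriv_by ?X ^^ j) u)) 1"
      by (rule arg_cong)
    moreover have "poly ([:- 1, 1:] ^ (t - j) * v) (1 :: int) = 0"
      using j by (simp add: poly_power)
    ultimately have "poly ((deriv_by ?X ^^ j) ?f) 1 = p * poly ((deriv_by ?X ^^ j) u) 1"
      by (simp only: poly_add poly_smult)
    then show ?thesis
      by (simp add: deriv_by_iter_sum mon poly_sum poly_monom)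
  qed
  \<comment> \<open>Inverts the Vandermonde system: q vanishes at every exponent except
    \<open>h k\<close>, and its degree is below t, so combining the power sums with the coefficients
    of q isolates \<open>c k\<close> times a unit.\<close>
  define q where "q = (\<Prod>l\<in>K - {k}. [:- int (h l), 1:])"
  have "degree q \<le> card (K - {k})"
    unfolding q_def by (rule order_trans[OF degree_prod_sum_le]) (use K in auto)
  then have degq: "degree q < t"
    using k K le card_Diff1_less[OF K k] by linarith
  have "p dvd (\<Sum>i\<le>degree q. coeff q i * (\<Sum>k\<in>K. c k * int (h k) ^ i))"
    by (intro dvd_sum dvd_mult pow) (use degq in auto)
  also have "\<dots> = (\<Sum>l\<in>K. c l * poly q (int (h l)))"
    unfolding poly_altdef sum_distrib_left by (subst sum.swap) (simp add: algebra_simps)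
  also have "\<dots> = (\<Sum>l\<in>K. if l = k then c k * poly q (int (h k)) else 0)"
    using K by (intro sum.cong) (auto simp: q_def poly_prod)
  also have "\<dots> = c k * poly q (int (h k))"
    using K k by simp
  finally have "p dvd c k * poly q (int (h k))" .
  moreover have "\<not> p dvd poly q (int (h k))"
  proof
    assume "p dvd poly q (int (h k))"
    then obtain l where l: "l \<in> K - {k}" "p dvd int (h k) - int (h l)"
      using p K by (auto simp: q_def poly_prod prime_dvd_prod_iff algebra_simps)
    moreover have "h k \<noteq> h l" using inj k l by (auto simp: inj_on_def)
    moreover have "\<bar>int (h k) - int (h l)\<bar> < p"
      using hp[of k] hp[of l] k l by auto
    ultimately show False
      using zdvd_imp_le[of p "\<bar>int (h k) - int (h l)\<bar>"] by auto
  qed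
  ultimately show ?thesis using p by (simp add: prime_dvd_mult_iff)
qed

text \<open>Pigeonhole in place of rank: p^|I| vectors of residues have only p^|E| possible images,
  and the difference of two vectors with the same image is a solution that is nonzero modulo
  p.\<close>

lemma exists_solution_homogeneous_system_mod:
  fixes p :: int and M :: "'e \<Rightarrow> 'i \<Rightarrow> int"
  assumes p: "p > 1" and I: "finite I" and E: "finite E" and less: "card E < card I"
  shows "\<exists>v :: 'i \<Rightarrow> int. (\<exists>i\<in>I. \<not> p dvd v i) \<and> (\<forall>e\<in>E. p dvd (\<Sum>i\<in>I. v i * M e i))"
proof -
  define V where "V = (I \<rightarrow>\<^sub>E {0..<p})"
  define T where "T = (E \<rightarrow>\<^sub>E {0..<p})"
  define F where "F = (\<lambda>v :: 'i \<Rightarrow> int. \<lambda>e\<in>E. (\<Sum>i\<in>I. v i * M e i) mod p)"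
  have "card V = nat p ^ card I" "card T = nat p ^ card E"
    using I E by (auto simp: V_def T_def card_PiE)
  then have "card T < card V"
    using p less by (simp add: power_strict_increasing)
  moreover have "finite T" using E by (simp add: T_def finite_PiE)
  moreover have "F ` V \<subseteq> T" using p by (auto simp: F_def T_def)
  ultimately have "\<not> inj_on F V"
    by (metis card_inj_on_le linorder_not_le)
  then obtain v w where vw: "v \<in> V" "w \<in> V" "v \<noteq> w" "F v = F w"
    by (auto simp: inj_on_def)
  then obtain i where i: "i \<in> I" "v i \<noteq> w i"
    unfolding V_def by (meson PiE_ext)
  have "\<not> p dvd v i - w i"
  proof
    assume "p dvd v i - w i"
    moreover have "v i \<in> {0..<p}" "w i \<in> {0..<p}"
      using vw i by (auto simp: V_def)
    ultimately show False
      using i zdvd_imp_le[of p "\<bar>v i - w i\<bar>"] by auto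
  qed
  moreover have "p dvd (\<Sum>i\<in>I. (v i - w i) * M e i)" if "e \<in> E" for e
  proof -
    have "(\<Sum>i\<in>I. v i * M e i) mod p = (\<Sum>i\<in>I. w i * M e i) mod p"
      using fun_cong[OF vw(4), of e] that by (simp add: F_def)
    then have "p dvd (\<Sum>i\<in>I. v i * M e i) - (\<Sum>i\<in>I. w i * M e i)"
      by (simp add: mod_eq_dvd_iff)
    then show ?thesis by (simp add: sum_subtractf algebra_simps)
  qed
  ultimately show ?thesis using i by (intro exI[of _ "\<lambda>i. v i - w i"]) auto
qed

section \<open>Stepanov's method\<close>

text \<open>At a point where X^t and (X - 1)^t both equal w, the last two factors take the constant
  value w^(b + c). The monomial has degree up to about 2 t B but behaves there like X^a, which is
  what makes vanishing to high order cheap.\<close>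

definition stepanov_monomial :: "nat \<Rightarrow> nat \<times> nat \<times> nat \<Rightarrow> int poly" where
  "stepanov_monomial t = (\<lambda>(a, b, c). [:0, 1:] ^ a * ([:0, 1:] ^ (t * b) * [:- 1, 1:] ^ (t * c)))"

text \<open>\<open>X (X - 1) d/dX\<close> maps each \<open>q \<cdot> X^(t b) (X - 1)^(t c)\<close> to a polynomial of the same
  shape, with the degree of the cofactor \<open>q\<close> raised by one.\<close>

fun stepanov_cofactor :: "nat \<Rightarrow> nat \<times> nat \<times> nat \<Rightarrow> nat \<Rightarrow> int poly" where
  "stepanov_cofactor t (a, b, c) 0 = [:0, 1:] ^ a"
| "stepanov_cofactor t (a, b, c) (Suc n) =
     deriv_by ([:0, 1:] * [:- 1, 1:]) (stepanov_cofactor t (a, b, c) n) +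
     (of_nat (t * b) * [:- 1, 1:] + of_nat (t * c) * [:0, 1:]) * stepanov_cofactor t (a, b, c) n"

lemma degree_stepanov_cofactor: "degree (stepanov_cofactor t (a, b, c) n) \<le> a + n"
proof (induction n)
  case 0
  show ?case using degree_power_le[of "[:0, 1:] :: int poly" a] by simp
next
  case (Suc n)
  let ?Q = "stepanov_cofactor t (a, b, c) n"
  have 1: "degree (deriv_by ([:0, 1:] * [:- 1, 1:]) ?Q) \<le> a + Suc n"
  proof (cases "degree ?Q = 0")
    case True
    then have "pderiv ?Q = 0" by (simp add: pderiv_eq_0_iff)
    then show ?thesis by (simp add: deriv_by_def)
  next
    case False
    have "degree (deriv_by ([:0, 1:] * [:- 1, 1:]) ?Q) \<le>
        degree ([:0, 1:] * [:- 1, 1:] :: int poly) + degree (pderiv ?Q)"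
      unfolding deriv_by_def by (rule degree_mult_le)
    moreover have "degree ([:0, 1:] * [:- 1, 1:] :: int poly) \<le> 2" by simp
    moreover have "degree (pderiv ?Q) = degree ?Q - 1" by (rule degree_pderiv)
    ultimately show ?thesis using False Suc by linarith
  qed
  have "degree (of_nat (t * b) * [:- 1, 1:] + of_nat (t * c) * [:0, 1:] :: int poly) \<le> 1"
    by (simp add: of_nat_poly)
  then have "degree ((of_nat (t * b) * [:- 1, 1:] + of_nat (t * c) * [:0, 1:]) * ?Q) \<le> a + Suc n"
    by (intro order_trans[OF degree_mult_le]) (use Suc in linarith)
  with 1 show ?case by (simp only: stepanov_cofactor.simps degree_add_le)
qed

lemma deriv_by_iter_stepanov_monomial:
  "(deriv_by ([:0, 1:] * [:- 1, 1:]) ^^ n) (stepanov_monomial t (a, b, c)) =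
     stepanov_cofactor t (a, b, c) n * ([:0, 1:] ^ (t * b) * [:- 1, 1:] ^ (t * c))"
proof (induction n)
  case 0
  then show ?case by (simp add: stepanov_monomial_def)
next
  case (Suc n)
  let ?X = "[:0, 1:] :: int poly" and ?Y = "[:- 1, 1:] :: int poly"
  let ?W = "?X ^ (t * b) * ?Y ^ (t * c)"
  have p: "of_nat m * l ^ (m - 1) * l = of_nat m * l ^ m" for m and l :: "int poly"
    by (cases m) (auto simp: algebra_simps)
  have X: "deriv_by (?X * ?Y) (?X ^ m) = of_nat m * ?Y * ?X ^ m" for m
  proof -
    have "deriv_by (?X * ?Y) (?X ^ m) = (of_nat m * ?X ^ (m - 1) * ?X) * ?Y"
      unfolding deriv_by_power by (simp add: deriv_by_def pderiv_pCons)
    then show ?thesis by (simp only: p) (simp only: ac_simps)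
  qed
  have Y: "deriv_by (?X * ?Y) (?Y ^ m) = of_nat m * ?X * ?Y ^ m" for m
  proof -
    have "deriv_by (?X * ?Y) (?Y ^ m) = (of_nat m * ?Y ^ (m - 1) * ?Y) * ?X"
      unfolding deriv_by_power by (simp add: deriv_by_def pderiv_pCons)
    then show ?thesis by (simp only: p) (simp only: ac_simps)
  qed
  have W: "deriv_by (?X * ?Y) ?W = (of_nat (t * b) * ?Y + of_nat (t * c) * ?X) * ?W"
    by (simp only: deriv_by_mult X Y) (simp only: ring_distribs ac_simps)
  have "(deriv_by (?X * ?Y) ^^ Suc n) (stepanov_monomial t (a, b, c)) =
      deriv_by (?X * ?Y) (stepanov_cofactor t (a, b, c) n * ?W)"
    using Suc by simp
  also have "\<dots> = stepanov_cofactor t (a, b, c) (Suc n) * ?W"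
    by (simp only: deriv_by_mult[of _ _ ?W] W stepanov_cofactor.simps) (simp only: ring_distribs ac_simps)
  finally show ?case .
qed

text \<open>Sort by powers of (X - 1)^t and take the lowest layer c0 with a coefficient not
  divisible by p. If the sum vanished modulo p, cancelling (X - 1)^(t c0) would make that layer a
  multiple of (X - 1)^t. But the layer has at most A B <= t terms, with distinct exponents below t B
  <= p, so the lacunary bound forces all its coefficients to be zero.\<close>

lemma stepanov_combination_not_zero_mod:
  fixes p :: int and v :: "nat \<times> nat \<times> nat \<Rightarrow> int"
  assumes p: "prime p" and AB: "A * B \<le> t" and tB: "int (t * B) \<le> p" and t: "t > 0"
    and i: "(a, b, c) \<in> {..<A} \<times> {..<B} \<times> {..<B}" "\<not> p dvd v (a, b, c)"
  shows "\<not> [:p:] dvd (\<Sum>i\<in>{..<A} \<times> {..<B} \<times> {..<B}. smult (v i) (stepanov_monomial t i))"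
proof
  let ?X = "[:0, 1:] :: int poly" and ?Y = "[:- 1, 1:] :: int poly"
  let ?K = "{..<A} \<times> {..<B}"
  assume dvd: "[:p:] dvd (\<Sum>i\<in>{..<A} \<times> {..<B} \<times> {..<B}. smult (v i) (stepanov_monomial t i))"
  define F where "F = (\<lambda>c. \<Sum>(a, b)\<in>?K. monom (v (a, b, c)) (a + t * b))"
  have swap: "(\<Sum>i\<in>{..<A} \<times> {..<B} \<times> {..<B}. smult (v i) (stepanov_monomial t i)) =
      (\<Sum>c<B. ?Y ^ (t * c) * F c)"
  proof -
    have "(\<Sum>c<B. ?Y ^ (t * c) * F c) =
        (\<Sum>c<B. \<Sum>(a, b)\<in>?K. smult (v (a, b, c)) (stepanov_monomial t (a, b, c)))"
      unfolding F_def sum_distrib_left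
      by (intro sum.cong refl)
         (auto simp: stepanov_monomial_def monom_altdef power_add algebra_simps)
    also have "\<dots> = (\<Sum>c<B. \<Sum>a<A. \<Sum>b<B. smult (v (a, b, c)) (stepanov_monomial t (a, b, c)))"
      by (simp add: sum.cartesian_product)
    also have "\<dots> = (\<Sum>a<A. \<Sum>c<B. \<Sum>b<B. smult (v (a, b, c)) (stepanov_monomial t (a, b, c)))"
      by (rule sum.swap)
    also have "\<dots> = (\<Sum>a<A. \<Sum>b<B. \<Sum>c<B. smult (v (a, b, c)) (stepanov_monomial t (a, b, c)))"
      by (rule sum.cong[OF refl], rule sum.swap)
    also have "\<dots> = (\<Sum>i\<in>{..<A} \<times> {..<B} \<times> {..<B}. smult (v i) (stepanov_monomial t i))"
      by (simp add: sum.cartesian_product)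
    finally show ?thesis by simp
  qed
  define c0 where "c0 = (LEAST c. \<exists>k\<in>?K. \<not> p dvd v (fst k, snd k, c))"
  have ex: "\<exists>k\<in>?K. \<not> p dvd v (fst k, snd k, c)"
    using i by force
  have c0: "\<exists>k\<in>?K. \<not> p dvd v (fst k, snd k, c0)"
    unfolding c0_def using ex by (rule LeastI)
  have "c0 \<le> c"
    unfolding c0_def using ex by (rule Least_le)
  then have c0B: "c0 < B" using i by simp
  have min: "[:p:] dvd F c'" if "c' < c0" for c'
  proof -
    have "\<forall>k\<in>?K. p dvd v (fst k, snd k, c')"
      using not_less_Least[of c'] that unfolding c0_def by blast
    then show ?thesis
      unfolding F_def by (intro dvd_sum) (auto simp: const_poly_dvd_iff)
  qed
  have split: "(\<Sum>c<B. ?Y ^ (t * c) * F c) = (\<Sum>c<c0. ?Y ^ (t * c) * F c) +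
      ?Y ^ (t * c0) * (F c0 + ?Y ^ t * (\<Sum>c\<in>{c0<..<B}. ?Y ^ (t * (c - Suc c0)) * F c))"
  proof -
    have "{..<B} = {..<c0} \<union> insert c0 {c0<..<B}" using c0B by auto
    moreover have "(\<Sum>c\<in>{..<c0} \<union> insert c0 {c0<..<B}. f c) =
        (\<Sum>c<c0. f c) + (f c0 + (\<Sum>c\<in>{c0<..<B}. f c))" for f :: "nat \<Rightarrow> int poly"
      by (subst sum.union_disjoint) auto
    ultimately have "(\<Sum>c<B. ?Y ^ (t * c) * F c) = (\<Sum>c<c0. ?Y ^ (t * c) * F c) +
        (?Y ^ (t * c0) * F c0 + (\<Sum>c\<in>{c0<..<B}. ?Y ^ (t * c) * F c))"
      by presburger
    also have "(\<Sum>c\<in>{c0<..<B}. ?Y ^ (t * c) * F c) =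
        (\<Sum>c\<in>{c0<..<B}. ?Y ^ (t * c0) * (?Y ^ t * (?Y ^ (t * (c - Suc c0)) * F c)))"
    proof (intro sum.cong refl)
      fix c assume "c \<in> {c0<..<B}"
      then have "c = c0 + 1 + (c - Suc c0)" by auto
      then have "t * c = t * c0 + (t + t * (c - Suc c0))"
        by (metis add.assoc add_mult_distrib2 mult.right_neutral)
      then have "?Y ^ (t * c) = ?Y ^ (t * c0) * (?Y ^ t * ?Y ^ (t * (c - Suc c0)))"
        by (simp only: power_add)
      then show "?Y ^ (t * c) * F c = ?Y ^ (t * c0) * (?Y ^ t * (?Y ^ (t * (c - Suc c0)) * F c))"
        by (simp only: mult.assoc)
    qed
    finally show ?thesis by (simp only: sum_distrib_left ring_distribs)
  qed
  have "[:p:] dvd (\<Sum>c<c0. ?Y ^ (t * c) * F c)"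
    using min by (intro dvd_sum dvd_mult) auto
  then have "[:p:] dvd ?Y ^ (t * c0) * (F c0 + ?Y ^ t * (\<Sum>c\<in>{c0<..<B}. ?Y ^ (t * (c - Suc c0)) * F c))"
    using dvd unfolding swap split by (simp only: dvd_add_right_iff)
  moreover have pp: "prime_elem [:p:]"
    using p by (intro lift_prime_elem_poly) auto
  moreover have "\<not> [:p:] dvd ?Y ^ (t * c0)"
  proof
    assume "[:p:] dvd ?Y ^ (t * c0)"
    then have "[:p:] dvd ?Y" using pp prime_elem_dvd_power by blast
    then have "p dvd coeff ?Y 1" by (simp only: const_poly_dvd_iff)
    then show False using p not_prime_unit by auto
  qed
  ultimately have D: "[:p:] dvd F c0 + ?Y ^ t * (\<Sum>c\<in>{c0<..<B}. ?Y ^ (t * (c - Suc c0)) * F c)"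
    using prime_elem_dvd_multD by blast
  obtain k where k: "k \<in> ?K" "\<not> p dvd v (fst k, snd k, c0)" using c0 by blast
  have At: "A \<le> t"
  proof -
    have "A * 1 \<le> A * B" using c0B by (intro mult_le_mono2) simp
    then show ?thesis using AB by linarith
  qed
  have "p dvd v (fst k, snd k, c0)"
  proof (rule lacunary_not_dvd_power[where K = ?K and h = "\<lambda>k. fst k + t * snd k" and t = t
        and c = "\<lambda>k. v (fst k, snd k, c0)"
        and g = "\<Sum>c\<in>{c0<..<B}. ?Y ^ (t * (c - Suc c0)) * F c"])
    \<comment> \<open>Since a < A <= t, the exponent a + t b determines a as its remainder and b as
      its quotient by t.\<close>
    show "inj_on (\<lambda>k. fst k + t * snd k) ?K"
    proof (rule inj_onI)
      fix x y assume xy: "x \<in> ?K" "y \<in> ?K" and e: "fst x + t * snd x = fst y + t * snd y"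
      have "fst x < t" "fst y < t" using xy At by auto
      then have "fst x = (fst x + t * snd x) mod t" "fst y = (fst y + t * snd y) mod t"
        "snd x = (fst x + t * snd x) div t" "snd y = (fst y + t * snd y) div t" by auto
      then show "x = y" using e by (metis prod_eqI)
    qed
    show "int (fst k + t * snd k) < p" if "k \<in> ?K" for k
    proof -
      have "fst k < t" "Suc (snd k) \<le> B" using that At by auto
      then have "fst k + t * snd k < t * Suc (snd k)" by simp
      moreover have "t * Suc (snd k) \<le> t * B"
        using \<open>Suc (snd k) \<le> B\<close> by (rule mult_le_mono2)
      ultimately show ?thesis using tB by linarith
    qed
    show "[:p:] dvd (\<Sum>k\<in>?K. monom (v (fst k, snd k, c0)) (fst k + t * snd k)) +
      ?Y ^ t * (\<Sum>c\<in>{c0<..<B}. ?Y ^ (t * (c - Suc c0)) * F c)"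
      using D by (simp only: F_def case_prod_unfold)
  qed (use p AB k in auto)
  with k show False by simp
qed

lemma eq_if_dvd_diff_residues:
  fixes p :: int
  assumes "x \<in> {0..<p}" "y \<in> {0..<p}" "p dvd x - y"
  shows "x = y"
proof -
  have "x mod p = y mod p" using assms(3) by (simp add: mod_eq_dvd_iff)
  then show ?thesis using assms by simp
qed

text \<open>There are A B^2 free coefficients. For each w and each order n < D, vanishing at all
  points above w follows once a single polynomial of degree below A + D is zero modulo p; this makes
  |W| D (A + D) linear conditions. A nontrivial solution vanishes to order D on X while its degree
  is at most A + 2 t B.\<close>

lemma stepanov_bound:
  fixes p :: int and X W :: "int set"
  assumes p: "prime p" and AB: "A * B \<le> t" and t: "t > 0"
    and W: "finite W" "\<And>w. w \<in> W \<Longrightarrow> \<not> p dvd w"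
    and count: "card W * (D * (A + D)) < A * (B * B)"
    and tB: "int (t * B) \<le> p" and D: "int D \<le> p"
    and X: "X \<subseteq> {0..<p}"
      "\<And>x. x \<in> X \<Longrightarrow> \<exists>w\<in>W. [x ^ t = w] (mod p) \<and> [(x - 1) ^ t = w] (mod p)"
  shows "D * card X \<le> A + 2 * (t * B)"
proof -
  let ?X = "[:0, 1:] :: int poly" and ?Y = "[:- 1, 1:] :: int poly"
  let ?I = "{..<A} \<times> {..<B} \<times> {..<B}"
  let ?E = "W \<times> {..<D} \<times> {..<A + D}"
  \<comment> \<open>\<open>M (w, n, k) i\<close> is the coefficient of X^k in the n-th iterate of
    monomial i after both t-th powers have been replaced by w.\<close>
  define M where "M = (\<lambda>(w, n, k). \<lambda>i. w ^ (fst (snd i) + snd (snd i)) * coeff (stepanov_cofactor t i n) k)"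
  have "card ?E < card ?I"
    using count by (simp add: card_cartesian_product)
  then obtain v where v: "\<exists>i\<in>?I. \<not> p dvd v i" "\<forall>e\<in>?E. p dvd (\<Sum>i\<in>?I. v i * M e i)"
    using exists_solution_homogeneous_system_mod[of p ?I ?E M] W(1) prime_gt_1_int[OF p] by auto
  define \<Psi> where "\<Psi> = (\<Sum>i\<in>?I. smult (v i) (stepanov_monomial t i))"
  have nz: "\<not> [:p:] dvd \<Psi>"
    using v(1) stepanov_combination_not_zero_mod[OF p AB tB t] unfolding \<Psi>_def by fast
  have deg: "degree \<Psi> \<le> A + 2 * (t * B)"
    unfolding \<Psi>_def
  proof (intro degree_sum_le)
    fix i assume i: "i \<in> ?I"
    obtain a b c where abc: "i = (a, b, c)" by (cases i)
    have "degree (smult (v i) (stepanov_monomial t i)) \<le> degree (stepanov_monomial t i)"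
      by simp
    also have "\<dots> \<le> degree (?X ^ a) + (degree (?X ^ (t * b)) + degree (?Y ^ (t * c)))"
      unfolding abc stepanov_monomial_def prod.case
      by (intro order_trans[OF degree_mult_le] add_mono order_refl)
    also have "\<dots> \<le> a + (t * b + t * c)"
      using degree_power_le[of ?X a] degree_power_le[of ?X "t * b"] degree_power_le[of ?Y "t * c"]
      by simp
    also have "\<dots> \<le> A + (t * B + t * B)"
      using i abc by (intro add_mono mult_le_mono2) auto
    finally show "degree (smult (v i) (stepanov_monomial t i)) \<le> A + 2 * (t * B)" by simp
  qed auto
  have van: "p dvd poly ((deriv_by (?X * ?Y) ^^ n) \<Psi>) x" if x: "x \<in> X" and n: "n < D" for x n
  proof -
    obtain w where w: "w \<in> W" "[x ^ t = w] (mod p)" "[(x - 1) ^ t = w] (mod p)"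
      using X(2)[OF x] by blast
    have "poly ((deriv_by (?X * ?Y) ^^ n) \<Psi>) x =
        (\<Sum>i\<in>?I. v i * poly (stepanov_cofactor t i n) x *
           (x ^ (t * fst (snd i)) * (x - 1) ^ (t * snd (snd i))))"
      unfolding \<Psi>_def deriv_by_iter_sum deriv_by_iter_smult poly_sum
    proof (intro sum.cong refl)
      fix i assume "i \<in> ?I"
      obtain a b c where abc: "i = (a, b, c)" by (cases i)
      show "poly (smult (v i) ((deriv_by (?X * ?Y) ^^ n) (stepanov_monomial t i))) x =
          v i * poly (stepanov_cofactor t i n) x * (x ^ (t * fst (snd i)) * (x - 1) ^ (t * snd (snd i)))"
        unfolding abc deriv_by_iter_stepanov_monomial
        by (simp add: poly_power)
    qed
    \<comment> \<open>The large powers of x and x - 1 collapse to powers of w. What remains is a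
      polynomial in x of degree below A + D whose coefficients are zero modulo p by the choice of
      v.\<close>
    also have "[\<dots> = (\<Sum>i\<in>?I. v i * poly (stepanov_cofactor t i n) x * (w ^ fst (snd i) * w ^ snd (snd i)))] (mod p)"
      using w by (intro cong_sum cong_mult cong_refl) (simp_all add: power_mult cong_pow)
    also have "(\<Sum>i\<in>?I. v i * poly (stepanov_cofactor t i n) x * (w ^ fst (snd i) * w ^ snd (snd i))) =
        (\<Sum>i\<in>?I. \<Sum>k<A + D. x ^ k * (v i * M (w, n, k) i))"
    proof (intro sum.cong refl)
      fix i assume i: "i \<in> ?I"
      obtain a b c where abc: "i = (a, b, c)" by (cases i)
      have "degree (stepanov_cofactor t i n) < A + D"
        using degree_stepanov_cofactor[of t a b c n] i n abc by auto
      then have "poly (stepanov_cofactor t i n) x = (\<Sum>k<A + D. coeff (stepanov_cofactor t i n) k * x ^ k)"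
        unfolding poly_altdef by (intro sum.mono_neutral_left) (auto simp: coeff_eq_0)
      then show "v i * poly (stepanov_cofactor t i n) x * (w ^ fst (snd i) * w ^ snd (snd i)) =
          (\<Sum>k<A + D. x ^ k * (v i * M (w, n, k) i))"
        by (simp add: M_def sum_distrib_left sum_distrib_right power_add algebra_simps)
    qed
    also have "\<dots> = (\<Sum>k<A + D. x ^ k * (\<Sum>i\<in>?I. v i * M (w, n, k) i))"
      by (subst sum.swap) (simp add: sum_distrib_left)
    also have "[\<dots> = 0] (mod p)"
      unfolding cong_0_iff
    proof (rule dvd_sum, rule dvd_mult)
      fix k assume "k \<in> {..<A + D}"
      then have "(w, n, k) \<in> ?E" using w(1) n by simp
      then show "p dvd (\<Sum>i\<in>?I. v i * M (w, n, k) i)" using v(2) by blast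
    qed
    finally show ?thesis by (simp add: cong_0_iff)
  qed
  have "(\<Sum>x\<in>X. D) \<le> degree \<Psi>"
  proof (rule sum_root_multiplicities_mod_le_degree[OF p nz])
    show "finite X" using X(1) finite_subset by blast
    show "x = y" if "x \<in> X" "y \<in> X" "p dvd x - y" for x y
      using that X(1) eq_if_dvd_diff_residues by blast
    show "int D \<le> p" by (fact D)
    fix x n assume x: "x \<in> X" and n: "n < D"
    obtain w where w: "w \<in> W" "[x ^ t = w] (mod p)" "[(x - 1) ^ t = w] (mod p)"
      using X(2)[OF x] by blast
    \<comment> \<open>As w is a unit, so are x and x - 1, hence also X (X - 1) at x; the change back
      to ordinary derivatives is therefore permitted.\<close>
    have "\<not> p dvd x" "\<not> p dvd x - 1"
      using w W(2)[OF w(1)] t by (meson cong_dvd_iff dvd_power dvd_trans)+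
    moreover have "poly (?X * ?Y) x = x * (x - 1)" by (simp add: algebra_simps)
    ultimately have "\<not> p dvd poly (?X * ?Y) x"
      using p by (auto simp only: prime_dvd_mult_iff)
    moreover have "p dvd poly ((deriv_by (?X * ?Y) ^^ n) \<Psi>) x" if "n < D" for n
      using van[OF x that] .
    ultimately show "p dvd poly ((pderiv ^^ n) \<Psi>) x"
      using pderiv_iter_dvd_if_deriv_by_iter_dvd[OF p _ _ n] by blast
  qed
  then show ?thesis using deg by (simp add: mult.commute)
qed

section \<open>Neighbouring residues with equal t-th powers\<close>

lemma finite_Collect_residues [simp]: "finite {x :: int. 0 \<le> x \<and> x < p \<and> P x}"
  by (rule finite_subset[of _ "{0..<p}"]) auto

lemma card_roots_power_mod_le:
  fixes p z :: int
  assumes p: "prime p" and t: "t > 0"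
  shows "card {x \<in> {0..<p}. [x ^ t = z] (mod p)} \<le> t"
proof -
  let ?f = "monom 1 t - [:z:] :: int poly"
  let ?S = "{x \<in> {0..<p}. [x ^ t = z] (mod p)}"
  have "coeff ?f t = 1" using t by (cases t) auto
  then have "\<not> [:p:] dvd ?f"
    using p not_prime_unit by (metis const_poly_dvd_iff)
  then have "(\<Sum>x\<in>?S. 1) \<le> degree ?f"
  proof (rule sum_root_multiplicities_mod_le_degree[OF p])
    fix x n assume "x \<in> ?S" "n < (1 :: nat)"
    then show "p dvd poly ((pderiv ^^ n) ?f) x"
      by (auto simp: poly_monom cong_iff_dvd_diff)
  qed (use eq_if_dvd_diff_residues prime_ge_1_int[OF p] in auto)
  moreover have "degree ?f \<le> t"
    by (intro degree_diff_le) (auto simp: degree_monom_le)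
  ultimately show ?thesis by simp
qed

text \<open>If c = g - h with t-th roots of unity g, h and c invertible, then x = g/c has x - 1 =
  h/c, and both t-th powers equal c^(-t). These sets thus control the number of representations of c
  as a difference.\<close>

definition consecutive_powers :: "int \<Rightarrow> nat \<Rightarrow> int \<Rightarrow> int set" where
  "consecutive_powers p t w = {x \<in> {0..<p}. [x ^ t = w] (mod p) \<and> [(x - 1) ^ t = w] (mod p)}"

lemma finite_consecutive_powers [simp]: "finite (consecutive_powers p t w)"
  by (simp add: consecutive_powers_def)

lemma card_UN_consecutive_powers:
  assumes "W \<subseteq> {1..<p}"
  shows "card (\<Union>w\<in>W. consecutive_powers p t w) = (\<Sum>w\<in>W. card (consecutive_powers p t w))"
proof (rule card_UN_disjoint)
  show "finite W" using assms finite_subset by blast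
  show "\<forall>w\<in>W. \<forall>w'\<in>W. w \<noteq> w' \<longrightarrow> consecutive_powers p t w \<inter> consecutive_powers p t w' = {}"
  proof (intro ballI impI equals0I)
    fix w w' x assume w: "w \<in> W" "w' \<in> W" "w \<noteq> w'"
      and "x \<in> consecutive_powers p t w \<inter> consecutive_powers p t w'"
    then have "[w = w'] (mod p)"
      by (auto simp: consecutive_powers_def intro: cong_trans cong_sym)
    then show False
      using w assms eq_if_dvd_diff_residues[of w p w'] by (force simp: cong_iff_dvd_diff)
  qed
qed auto

text \<open>All these x are roots of X^t - (X - 1)^t, which is nonzero modulo p because its value at
  0 is 1 or -1.\<close>

lemma sum_card_consecutive_powers_le:
  assumes p: "prime p" and t: "t > 0" and W: "W \<subseteq> {1..<p}"
  shows "(\<Sum>w\<in>W. card (consecutive_powers p t w)) \<le> t"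
proof -
  let ?f = "monom 1 t - [:- 1, 1:] ^ t :: int poly"
  let ?S = "{x \<in> {0..<p}. [x ^ t = (x - 1) ^ t] (mod p)}"
  have f: "poly ?f x = x ^ t - (x - 1) ^ t" for x
    by (simp add: poly_monom poly_power algebra_simps)
  have "\<not> [:p:] dvd ?f"
  proof
    assume "[:p:] dvd ?f"
    then obtain k where "?f = [:p:] * k" by (elim dvdE)
    then have "poly ?f 0 = poly ([:p:] * k) 0" by (rule arg_cong)
    then have "p dvd poly ?f 0" by (simp only: poly_mult) simp
    then have "p dvd (- 1) ^ t" unfolding f using t by (simp add: zero_power)
    then show False using p by (cases "even t") (auto simp: not_prime_unit)
  qed
  then have "(\<Sum>x\<in>?S. 1) \<le> degree ?f"
  proof (rule sum_root_multiplicities_mod_le_degree[OF p])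
    fix x n assume "x \<in> ?S" "n < (1 :: nat)"
    then show "p dvd poly ((pderiv ^^ n) ?f) x"
      by (simp only: less_one funpow_0 f cong_iff_dvd_diff mem_Collect_eq)
  qed (use eq_if_dvd_diff_residues prime_ge_1_int[OF p] in auto)
  moreover have "degree ?f \<le> t"
    by (intro degree_diff_le) (use degree_power_le[of "[:- 1, 1:] :: int poly" t] in \<open>auto simp: degree_monom_le\<close>)
  ultimately have "card ?S \<le> t" by simp
  moreover have "card (\<Union>w\<in>W. consecutive_powers p t w) \<le> card ?S"
    by (intro card_mono) (auto simp: consecutive_powers_def intro: cong_trans cong_sym)
  ultimately show ?thesis using card_UN_consecutive_powers[OF W] by simp
qed

text \<open>The parameters balance \<open>A B \<le> t\<close> against \<open>2 s A < B^2\<close>: \<open>B\<close> is close to \<open>(2 s t)^(1/3)\<close>.\<close>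

lemma card_level_set_consecutive_powers:
  assumes p: "prime p" and t: "t > 0" and tp: "int (t * t) \<le> p" and W: "W \<subseteq> {1..<p}"
    and \<tau>: "\<And>w. w \<in> W \<Longrightarrow> \<tau> \<le> card (consecutive_powers p t w)"
  shows "card W * \<tau> \<le> t" and "card W * \<tau> ^ 3 \<le> 32000 * t ^ 2"
proof -
  define s where "s = card W"
  define X where "X = (\<Union>w\<in>W. consecutive_powers p t w)"
  have finW: "finite W" using W finite_subset by blast
  have X: "card X = (\<Sum>w\<in>W. card (consecutive_powers p t w))"
    unfolding X_def by (rule card_UN_consecutive_powers[OF W])
  have sX: "s * \<tau> \<le> card X"
    unfolding X s_def using sum_bounded_below[of W \<tau> "\<lambda>w. card (consecutive_powers p t w)"] \<tau> by simp
  moreover have Xt: "card X \<le> t" unfolding X by (rule sum_card_consecutive_powers_le[OF p t W])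
  ultimately show st: "card W * \<tau> \<le> t" by (simp add: s_def)
  have goal: "s * \<tau> ^ 3 \<le> 32000 * t ^ 2"
  proof (cases "s = 0 \<or> \<tau> = 0")
    case True
    then show ?thesis by auto
  next
    case False
    then have pos: "s > 0" "\<tau> > 0" by auto
    have s: "s * \<tau> \<le> t" using st by (simp add: s_def)
    have "s * 1 \<le> s * \<tau>" "1 * \<tau> \<le> s * \<tau>" using pos by (auto intro: mult_le_mono)
    then have le: "s \<le> t" "\<tau> \<le> t" using s by linarith+
    show ?thesis
    \<comment> \<open>For t > 2 the bound s <= t gives 2 s < t^2, which ensures B <= t and hence A
      >= 1 below. For t <= 2 the trivial bounds suffice.\<close>
    proof (cases "t \<le> 2")
      case True
      have "s * \<tau> ^ 3 = s * \<tau> * \<tau> ^ 2" by (simp add: power2_eq_square power3_eq_cube)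
      also have "\<dots> \<le> t * t ^ 2" using s le by (intro mult_mono power_mono) auto
      also have "\<dots> \<le> 2 * t ^ 2" using True by (intro mult_right_mono) auto
      finally show ?thesis by simp
    next
      case False
      have "2 * s < t * t"
      proof -
        have "2 * s < 3 * t" using le t by linarith
        also have "\<dots> \<le> t * t" using False by (intro mult_right_mono) auto
        finally show ?thesis .
      qed
      then have tt: "2 * s * t < t ^ 3" using t by (simp add: power3_eq_cube)
      \<comment> \<open>B is the least value for which the linear system is underdetermined;
        minimality, with B <= 2 (B - 1), gives B^3 <= 8 * 2 s t in return.\<close>
      define B where "B = (LEAST B. 2 * s * t < B ^ 3)"
      have B: "2 * s * t < B ^ 3" unfolding B_def using tt by (rule LeastI)
      have Bt: "B \<le> t" unfolding B_def using tt by (rule Least_le)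
      have B2: "B \<ge> 2"
      proof (rule ccontr)
        assume "\<not> B \<ge> 2"
        then have "B ^ 3 \<le> 1 ^ 3" by (intro power_mono) auto
        moreover have "2 * s * t \<ge> 1" using pos t by (simp add: Suc_leI)
        ultimately show False using B by simp
      qed
      have "\<not> 2 * s * t < (B - 1) ^ 3"
        using not_less_Least[of "B - 1" "\<lambda>B. 2 * s * t < B ^ 3"] B2 unfolding B_def[symmetric] by simp
      moreover have "B ^ 3 \<le> (2 * (B - 1)) ^ 3" using B2 by (intro power_mono) auto
      ultimately have B3: "B ^ 3 \<le> 16 * (s * t)" by (simp add: power_mult_distrib)
      define A where "A = t div B"
      have AB: "A * B \<le> t" unfolding A_def by (simp add: div_times_less_eq_dividend)
      have A1: "A \<ge> 1" using Bt B2 unfolding A_def by (simp add: Suc_leI div_greater_zero_iff)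
      have At: "A \<le> t" unfolding A_def by (rule div_le_dividend)
      have tAB: "t \<le> 2 * (A * B)"
      proof -
        have "t < B + B * A"
          using B2 dividend_less_div_times[of B t] unfolding A_def by (simp add: mult.commute)
        moreover have "B \<le> B * A" using A1 by simp
        moreover have "B * A = A * B" by (rule mult.commute)
        ultimately show ?thesis by linarith
      qed
      have "2 * s * A * B \<le> 2 * s * t" using AB by (simp add: mult.assoc)
      also have "\<dots> < B * B * B" using B by (simp add: power3_eq_cube)
      finally have sAB: "2 * s * A < B * B" by simp
      \<comment> \<open>The order of vanishing D is taken equal to A, so the counting condition
        reads 2 s A < B^2.\<close>
      have "A * card X \<le> A + 2 * (t * B)"
      proof (rule stepanov_bound[OF p AB t finW])
        show "\<not> p dvd w" if "w \<in> W" for w using that W zdvd_not_zless by auto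
        have "card W * (A * (A + A)) = A * (2 * s * A)" by (simp add: s_def algebra_simps)
        also have "\<dots> < A * (B * B)" using sAB A1 by (intro mult_strict_left_mono) auto
        finally show "card W * (A * (A + A)) < A * (B * B)" .
        have "t * B \<le> t * t" using Bt by simp
        then show "int (t * B) \<le> p" using tp by linarith
        have "A * 1 \<le> t * t" using At t by (intro mult_le_mono) auto
        then show "int A \<le> p" using tp by linarith
        show "X \<subseteq> {0..<p}" by (auto simp: X_def consecutive_powers_def)
        show "\<exists>w\<in>W. [x ^ t = w] (mod p) \<and> [(x - 1) ^ t = w] (mod p)" if "x \<in> X" for x
          using that by (auto simp: X_def consecutive_powers_def)
      qed
      also have "\<dots> \<le> A * (B * B) + 2 * (2 * (A * B) * B)"
      proof (intro add_mono mult_le_mono2 mult_le_mono1 tAB)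
        have "1 * 1 \<le> B * B" using B2 by (intro mult_le_mono) auto
        then have "A * 1 \<le> A * (B * B)" by (intro mult_le_mono2) simp
        then show "A \<le> A * (B * B)" by simp
      qed
      also have "\<dots> = A * (5 * B ^ 2)" by (simp add: power2_eq_square)
      finally have "card X \<le> 5 * B ^ 2" using A1 by simp
      then have "s * \<tau> \<le> 5 * B ^ 2" using sX by linarith
      \<comment> \<open>Cubing avoids the cube root hidden in B: the constant is 5^3 * 16^2 = 32000,
        and s^2 cancels.\<close>
      then have "(s * \<tau>) ^ 3 \<le> (5 * B ^ 2) ^ 3" by (intro power_mono) auto
      also have "\<dots> = 125 * (B ^ 3) ^ 2" by (simp add: power_mult_distrib flip: power_mult)
      also have "\<dots> \<le> 125 * (16 * (s * t)) ^ 2" using B3 by (intro mult_le_mono2 power_mono) auto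
      finally have "s ^ 2 * (s * \<tau> ^ 3) \<le> s ^ 2 * (32000 * t ^ 2)"
        by (simp add: power_mult_distrib power2_eq_square power3_eq_cube algebra_simps)
      then show ?thesis using pos by simp
    qed
  qed
  show "card W * \<tau> ^ 3 \<le> 32000 * t ^ 2" using goal by (simp add: s_def)
qed

text \<open>Layer-cake summation: n^2 <= 2 (1 + ... + n) turns the sum of squares into a sum of 2
  \<tau> times the size of the level set at \<tau>. That size is O(t^(3/2) / \<tau>^2), and the
  harmonic sum over \<tau> produces the logarithm.\<close>

lemma sum_card_consecutive_powers_squared_le:
  assumes p: "prime p" and t: "t > 0" and tp: "int (t * t) \<le> p"
  shows "(\<Sum>w\<in>{1..<p}. real (card (consecutive_powers p t w)) ^ 2) \<le>
    358 * (real t powr (3/2) * (1 + ln (real t)))"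
proof -
  let ?N = "\<lambda>w. card (consecutive_powers p t w)"
  let ?L = "\<lambda>\<tau>. {w \<in> {1..<p}. \<tau> \<le> ?N w}"
  have N: "?N w \<le> t" for w
  proof -
    have "?N w \<le> card {x \<in> {0..<p}. [x ^ t = w] (mod p)}"
      by (intro card_mono) (auto simp: consecutive_powers_def)
    with card_roots_power_mod_le[OF p t, of w] show ?thesis by simp
  qed
  have sq: "real n ^ 2 \<le> (\<Sum>\<tau>\<in>{1..t}. if \<tau> \<le> n then 2 * real \<tau> else 0)" if "n \<le> t" for n
  proof -
    have "(\<Sum>\<tau>\<in>{1..t}. if \<tau> \<le> n then 2 * real \<tau> else 0) = (\<Sum>\<tau>\<in>{1..n}. 2 * real \<tau>)"
      using that by (intro sum.mono_neutral_cong_right) auto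
    also have "\<dots> = real n * (real n + 1)"
      by (induction n) (auto simp: algebra_simps)
    finally show ?thesis by (simp add: power2_eq_square algebra_simps)
  qed
  have "(\<Sum>w\<in>{1..<p}. real (?N w) ^ 2) \<le>
      (\<Sum>w\<in>{1..<p}. \<Sum>\<tau>\<in>{1..t}. if \<tau> \<le> ?N w then 2 * real \<tau> else 0)"
    by (intro sum_mono sq N)
  also have "\<dots> = (\<Sum>\<tau>\<in>{1..t}. \<Sum>w\<in>{1..<p}. if \<tau> \<le> ?N w then 2 * real \<tau> else 0)"
    by (rule sum.swap)
  also have "\<dots> = (\<Sum>\<tau>\<in>{1..t}. 2 * real \<tau> * real (card (?L \<tau>)))"
    by (intro sum.cong refl) (simp add: sum.If_cases Int_def mult.commute)
  also have "\<dots> \<le> (\<Sum>\<tau>\<in>{1..t}. 358 * (real t powr (3/2) * inverse (real \<tau>)))"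
  proof (intro sum_mono)
    fix \<tau> assume \<tau>: "\<tau> \<in> {1..t}"
    define s where "s = real (card (?L \<tau>))"
    have L: "?L \<tau> \<subseteq> {1..<p}" "\<And>w. w \<in> ?L \<tau> \<Longrightarrow> \<tau> \<le> ?N w" by blast+
    note 1 = card_level_set_consecutive_powers[OF p t tp L]
    have "0 \<le> s" by (simp add: s_def)
    have s: "s * real \<tau> \<le> real t" "s * real \<tau> ^ 3 \<le> 32000 * real t ^ 2"
      using 1[THEN of_nat_mono, where 'a = real] by (simp_all add: s_def)
    \<comment> \<open>The geometric mean of the two level set bounds has exactly the weight
      \<tau>^2; the constant is 179 because 179^2 >= 32000.\<close>
    have "(s * real \<tau> ^ 2) ^ 2 = (s * real \<tau>) * (s * real \<tau> ^ 3)"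
      by (simp add: power2_eq_square power3_eq_cube)
    also have "\<dots> \<le> real t * (32000 * real t ^ 2)"
      by (rule mult_mono) (use s \<open>0 \<le> s\<close> in simp_all)
    also have "\<dots> \<le> (179 * real t powr (3/2)) ^ 2"
    proof -
      have "(real t powr (3/2)) ^ 2 = real t ^ 3"
        using t by (simp add: powr_power)
      then show ?thesis by (simp add: power_mult_distrib power2_eq_square power3_eq_cube)
    qed
    finally have "s * real \<tau> ^ 2 \<le> 179 * real t powr (3/2)"
      by (rule power2_le_imp_le) auto
    then show "2 * real \<tau> * real (card (?L \<tau>)) \<le> 358 * (real t powr (3/2) * inverse (real \<tau>))"
      using \<tau> unfolding s_def[symmetric] by (simp add: field_simps power2_eq_square)
  qed
  also have "\<dots> = 358 * (real t powr (3/2) * harm t)"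
    by (simp add: harm_def sum_distrib_left)
  also have "harm t \<le> 1 + ln (real t)"
    using euler_mascheroni_sequence_decreasing[of 1 t] t by (simp add: harm_def)
  finally show ?thesis by (simp add: mult_left_mono)
qed

section \<open>Additive energy of a multiplicative subgroup\<close>

definition unity_roots_mod :: "int \<Rightarrow> nat \<Rightarrow> int set" where
  "unity_roots_mod p t = {g \<in> {0..<p}. [g ^ t = 1] (mod p)}"

text \<open>Additive energy in its difference form, which is what expanding the square of S times
  its conjugate produces.\<close>

definition energy_mod :: "int \<Rightarrow> int set \<Rightarrow> nat" where
  "energy_mod p G = card {(q, r) \<in> (G \<times> G) \<times> (G \<times> G). [fst q - snd q = fst r - snd r] (mod p)}"

lemma finite_unity_roots_mod [simp]: "finite (unity_roots_mod p t)"
  by (simp add: unity_roots_mod_def)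

lemma card_unity_roots_mod_le:
  assumes "prime p" "t > 0"
  shows "card (unity_roots_mod p t) \<le> t"
  using card_roots_power_mod_le[OF assms, of 1] by (simp add: unity_roots_mod_def)

lemma coprime_unity_root_mod:
  assumes "t > 0" "g \<in> unity_roots_mod p t"
  shows "coprime g p"
proof -
  have "[g ^ t = 1] (mod p)" using assms by (simp add: unity_roots_mod_def)
  then have "coprime (g ^ t) p" by (metis cong_imp_coprime cong_sym coprime_1_left)
  then show ?thesis using assms(1) by simp
qed

text \<open>The energy is the sum over c of the squared number of representations c = g - h. The
  class c = 0 contributes at most t^2. For c nonzero, division by c bounds the count by the size of
  the set of consecutive powers at w = c^(-t), and at most t values of c share the same w.\<close>

lemma energy_unity_roots_mod_le:
  assumes p: "prime p" and t: "t > 0" and tp: "int (t * t) \<le> p"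
  shows "real (energy_mod p (unity_roots_mod p t)) \<le>
    real t ^ 2 + real t * (358 * (real t powr (3/2) * (1 + ln (real t))))"
proof -
  let ?G = "unity_roots_mod p t"
  let ?N = "\<lambda>w. card (consecutive_powers p t w)"
  define R where "R = (\<lambda>c. {q \<in> ?G \<times> ?G. [fst q - snd q = c] (mod p)})"
  have finR: "finite (R c)" for c by (simp add: R_def)
  let ?Q = "{(q, r) \<in> (?G \<times> ?G) \<times> (?G \<times> ?G). [fst q - snd q = fst r - snd r] (mod p)}"
  have p0: "p > 0" using p prime_gt_0_int by blast
  have "card ?Q \<le> card (Sigma {0..<p} (\<lambda>c. R c \<times> R c))"
  proof (rule card_inj_on_le)
    let ?f = "\<lambda>(q :: int \<times> int, r :: int \<times> int). ((fst q - snd q) mod p, (q, r))"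
    show "inj_on ?f ?Q" by (auto simp: inj_on_def)
    show "?f ` ?Q \<subseteq> Sigma {0..<p} (\<lambda>c. R c \<times> R c)"
      using p0 by (auto simp: R_def cong_def)
  qed (auto intro: finR)
  also have "\<dots> = (\<Sum>c\<in>{0..<p}. card (R c) ^ 2)"
    by (simp add: finR card_cartesian_product power2_eq_square)
  also have "{0..<p} = insert 0 {1..<p}" using p0 by auto
  also have "(\<Sum>c\<in>insert 0 {1..<p}. card (R c) ^ 2) = card (R 0) ^ 2 + (\<Sum>c\<in>{1..<p}. card (R c) ^ 2)"
    by simp
  finally have Q: "card ?Q \<le> card (R 0) ^ 2 + (\<Sum>c\<in>{1..<p}. card (R c) ^ 2)" .
  have snd_eq: "h = h'" if "(g, h) \<in> R c" "(g, h') \<in> R c" for g h h' c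
  proof -
    have "[g - h = g - h'] (mod p)" using that by (auto simp: R_def intro: cong_trans cong_sym)
    then have "p dvd h' - h" by (simp add: cong_iff_dvd_diff)
    then show ?thesis
      using that eq_if_dvd_diff_residues[of h' p h] by (auto simp: R_def unity_roots_mod_def)
  qed
  have "card (R 0) \<le> card ?G"
    by (rule card_inj_on_le[of fst]) (auto simp: R_def inj_on_def intro: snd_eq[unfolded R_def])
  with card_unity_roots_mod_le[OF p t] have R0: "card (R 0) \<le> t" by simp
  have "\<exists>e. [c * e = 1] (mod p)" if "c \<in> {1..<p}" for c
  proof (rule cong_solve_coprime_int)
    have "\<not> p dvd c" using that zdvd_not_zless by auto
    then show "coprime c p" using p by (metis coprime_commute prime_imp_coprime)
  qed
  then obtain e where e: "\<And>c. c \<in> {1..<p} \<Longrightarrow> [c * e c = 1] (mod p)" by metis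
  \<comment> \<open>\<open>e c\<close> is an inverse of c modulo p, so \<open>w c\<close> is the
    residue of c^(-t).\<close>
  define w where "w = (\<lambda>c. e c ^ t mod p)"
  have ew: "[c ^ t * w c = 1] (mod p)" if "c \<in> {1..<p}" for c
  proof -
    have "[(c * e c) ^ t = 1 ^ t] (mod p)" using e[OF that] by (rule cong_pow)
    then have "[c ^ t * e c ^ t = 1] (mod p)" by (simp add: power_mult_distrib)
    then show ?thesis unfolding w_def by (simp add: cong_def mod_mult_right_eq)
  qed
  have wU: "w c \<in> {1..<p}" if "c \<in> {1..<p}" for c
  proof -
    have "w c \<noteq> 0"
    proof
      assume "w c = 0"
      then have "[0 = 1] (mod p)" using ew[OF that] by simp
      then show False using prime_gt_1_int[OF p] by (simp add: cong_def)
    qed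
    moreover have "w c \<ge> 0" "w c < p" using p0 by (simp_all add: w_def)
    ultimately show ?thesis by simp
  qed
  have RN: "card (R c) \<le> ?N (w c)" if c: "c \<in> {1..<p}" for c
  proof (rule card_inj_on_le[of "\<lambda>q. (e c * fst q) mod p"])
    show "inj_on (\<lambda>q. (e c * fst q) mod p) (R c)"
    proof (rule inj_onI)
      fix q r assume q: "q \<in> R c" "r \<in> R c" and eq: "(e c * fst q) mod p = (e c * fst r) mod p"
      have "[e c * fst q = e c * fst r] (mod p)"
        using eq by (simp add: cong_def)
      then have "[c * (e c * fst q) = c * (e c * fst r)] (mod p)"
        by (rule cong_scalar_left)
      moreover have "[c * (e c * x) = 1 * x] (mod p)" for x
        using cong_scalar_right[OF e[OF c], of x] by (simp add: mult.assoc)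
      ultimately have "[1 * fst q = 1 * fst r] (mod p)"
        by (meson cong_sym cong_trans)
      then have "fst q = fst r"
        using q eq_if_dvd_diff_residues[of "fst q" p "fst r"]
        by (auto simp: R_def unity_roots_mod_def cong_iff_dvd_diff)
      then show "q = r" using q snd_eq by (metis prod.collapse)
    qed
    show "(\<lambda>q. (e c * fst q) mod p) ` R c \<subseteq> consecutive_powers p t (w c)"
    proof
      fix x assume "x \<in> (\<lambda>q. (e c * fst q) mod p) ` R c"
      then obtain g h where gh: "(g, h) \<in> R c" and x: "x = (e c * g) mod p" by auto
      have G: "[g ^ t = 1] (mod p)" "[h ^ t = 1] (mod p)" "[g - h = c] (mod p)"
        using gh by (auto simp: R_def unity_roots_mod_def)
      have x': "[x = e c * g] (mod p)" unfolding x by (simp add: cong_def)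
      have ec: "[e c ^ t = w c] (mod p)" unfolding w_def by (simp add: cong_def)
      have "[x ^ t = e c ^ t * g ^ t] (mod p)"
        using cong_pow[OF x', of t] by (simp add: power_mult_distrib)
      moreover have "[e c ^ t * g ^ t = w c * 1] (mod p)" by (intro cong_mult ec G)
      ultimately have 1: "[x ^ t = w c] (mod p)" by (metis cong_trans mult.right_neutral)
      have "[x - 1 = e c * g - c * e c] (mod p)"
        by (intro cong_diff x' cong_sym[OF e[OF c]])
      also have "[e c * g - c * e c = e c * g - (g - h) * e c] (mod p)"
        by (intro cong_diff cong_mult cong_refl cong_sym[OF G(3)])
      also have "e c * g - (g - h) * e c = e c * h" by (simp add: algebra_simps)
      finally have x1: "[x - 1 = e c * h] (mod p)" .
      have "[(x - 1) ^ t = e c ^ t * h ^ t] (mod p)"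
        using cong_pow[OF x1, of t] by (simp add: power_mult_distrib)
      moreover have "[e c ^ t * h ^ t = w c * 1] (mod p)" by (intro cong_mult ec G)
      ultimately have 2: "[(x - 1) ^ t = w c] (mod p)" by (metis cong_trans mult.right_neutral)
      show "x \<in> consecutive_powers p t (w c)"
        using 1 2 p0 by (simp add: consecutive_powers_def x)
    qed
  qed auto
  have fibre: "card {c \<in> {1..<p}. w c = v} \<le> t" if "v \<in> {1..<p}" for v
  proof (cases "{c \<in> {1..<p}. w c = v} = {}")
    case False
    then obtain c0 where c0: "c0 \<in> {1..<p}" "w c0 = v" by blast
    have "{c \<in> {1..<p}. w c = v} \<subseteq> {c \<in> {0..<p}. [c ^ t = c0 ^ t] (mod p)}"
    proof safe
      fix c assume c: "c \<in> {1..<p}" "v = w c"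
      then show "c \<in> {0..<p}" by auto
      have "[c ^ t * w c0 = c0 ^ t * w c0] (mod p)"
        using ew[OF c(1)] ew[OF c0(1)] c c0 by (metis cong_sym cong_trans)
      moreover have "coprime (w c0) p"
        using wU[OF c0(1)] p zdvd_not_zless by (metis atLeastLessThan_iff coprime_commute int_one_le_iff_zero_less prime_imp_coprime)
      ultimately show "[c ^ t = c0 ^ t] (mod p)" by (simp add: cong_mult_rcancel)
    qed
    then have "card {c \<in> {1..<p}. w c = v} \<le> card {c \<in> {0..<p}. [c ^ t = c0 ^ t] (mod p)}"
      by (intro card_mono) auto
    with card_roots_power_mod_le[OF p t, of "c0 ^ t"] show ?thesis by linarith
  qed (simp only: card.empty le0)
  have "(\<Sum>c\<in>{1..<p}. real (card (R c)) ^ 2) \<le> (\<Sum>c\<in>{1..<p}. real (?N (w c)) ^ 2)"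
    by (rule sum_mono) (simp add: RN power_mono)
  also have "\<dots> = (\<Sum>v\<in>{1..<p}. \<Sum>c\<in>{c \<in> {1..<p}. w c = v}. real (?N (w c)) ^ 2)"
    by (rule sum.group[symmetric]) (use wU in blast)+
  also have "\<dots> = (\<Sum>v\<in>{1..<p}. real (card {c \<in> {1..<p}. w c = v}) * real (?N v) ^ 2)"
  proof (rule sum.cong[OF refl])
    fix v
    have "(\<Sum>c\<in>{c \<in> {1..<p}. w c = v}. real (?N (w c)) ^ 2) = (\<Sum>c\<in>{c \<in> {1..<p}. w c = v}. real (?N v) ^ 2)"
      by (rule sum.cong) blast+
    then show "(\<Sum>c\<in>{c \<in> {1..<p}. w c = v}. real (?N (w c)) ^ 2) =
        real (card {c \<in> {1..<p}. w c = v}) * real (?N v) ^ 2"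
      by (simp only: sum_constant)
  qed
  also have "\<dots> \<le> (\<Sum>v\<in>{1..<p}. real t * real (?N v) ^ 2)"
    by (rule sum_mono, rule mult_right_mono) (use fibre of_nat_le_iff in blast, rule zero_le_power2)
  also have "\<dots> = real t * (\<Sum>v\<in>{1..<p}. real (?N v) ^ 2)"
    by (simp add: sum_distrib_left)
  also have "\<dots> \<le> real t * (358 * (real t powr (3/2) * (1 + ln (real t))))"
    by (intro mult_left_mono sum_card_consecutive_powers_squared_le p t tp) auto
  finally have S: "(\<Sum>c\<in>{1..<p}. real (card (R c)) ^ 2) \<le>
      real t * (358 * (real t powr (3/2) * (1 + ln (real t))))" .
  have "real (card ?Q) \<le> real (card (R 0) ^ 2 + (\<Sum>c\<in>{1..<p}. card (R c) ^ 2))"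
    using Q of_nat_le_iff by blast
  also have "\<dots> = real (card (R 0)) ^ 2 + (\<Sum>c\<in>{1..<p}. real (card (R c)) ^ 2)"
    by simp
  also have "\<dots> \<le> real t ^ 2 + real t * (358 * (real t powr (3/2) * (1 + ln (real t))))"
    by (intro add_mono S power_mono) (use R0 in auto)
  finally show ?thesis unfolding energy_mod_def .
qed

section \<open>Exponential sums over a subgroup\<close>

definition unit_char :: "int \<Rightarrow> int \<Rightarrow> complex" where
  "unit_char p n = cis (2 * pi * (of_int n / of_int p))"

definition exp_sum :: "int \<Rightarrow> int set \<Rightarrow> int \<Rightarrow> complex" where
  "exp_sum p G b = (\<Sum>g\<in>G. unit_char p (b * g))"

lemma unit_char_add: "unit_char p (m + n) = unit_char p m * unit_char p n"
  by (simp add: unit_char_def cis_mult add_divide_distrib distrib_left)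

lemma cnj_unit_char: "cnj (unit_char p n) = unit_char p (- n)"
  by (simp add: unit_char_def cis_cnj)

lemma norm_unit_char [simp]: "norm (unit_char p n) = 1"
  by (simp add: unit_char_def)

lemma unit_char_eq_1_iff:
  assumes "p > 0"
  shows "unit_char p n = 1 \<longleftrightarrow> p dvd n"
proof -
  have "unit_char p n = 1 \<longleftrightarrow> (\<exists>k. 2 * pi * (of_int n / of_int p) = of_int k * (2 * pi))"
    by (simp add: unit_char_def cis_eq_1_iff)
  also have "\<dots> \<longleftrightarrow> (\<exists>k. real_of_int n = of_int (p * k))"
    using assms by (simp add: field_simps)
  also have "\<dots> \<longleftrightarrow> p dvd n"
    unfolding of_int_eq_iff by (auto simp: dvd_def)
  finally show ?thesis .
qed

lemma unit_char_cong:
  assumes "p > 0" "[m = n] (mod p)"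
  shows "unit_char p m = unit_char p n"
proof -
  have "unit_char p (m - n) = 1"
    using assms by (simp add: unit_char_eq_1_iff cong_iff_dvd_diff)
  then show ?thesis using unit_char_add[of p "m - n" n] by simp
qed

lemma unit_char_power: "unit_char p n ^ k = unit_char p (int k * n)"
  by (induction k) (simp_all add: unit_char_add algebra_simps, simp add: unit_char_def)

lemma sum_unit_char:
  assumes p: "p > 0"
  shows "(\<Sum>b\<in>{0..<p}. unit_char p (b * n)) = (if p dvd n then of_int p else 0)"
proof -
  have im: "{0..<p} = int ` {..<nat p}"
    using p by (simp add: image_int_atLeastLessThan lessThan_atLeast0)
  have "(\<Sum>b\<in>{0..<p}. unit_char p (b * n)) = (\<Sum>k<nat p. unit_char p n ^ k)"
    unfolding im by (subst sum.reindex) (simp_all add: unit_char_power)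
  also have "\<dots> = (if p dvd n then of_int p else 0)"
  proof (cases "p dvd n")
    case True
    then have "unit_char p n = 1" using p by (simp add: unit_char_eq_1_iff)
    then show ?thesis using True p by simp
  next
    case False
    then have "unit_char p n \<noteq> 1" using p by (simp add: unit_char_eq_1_iff)
    moreover have "unit_char p n ^ nat p = 1"
      using p by (simp add: unit_char_power unit_char_eq_1_iff)
    ultimately show ?thesis using False by (simp add: geometric_sum)
  qed
  finally show ?thesis .
qed

lemma exp_sum_uminus: "exp_sum p G (- b) = cnj (exp_sum p G b)"
  by (simp add: exp_sum_def cnj_unit_char)

lemma exp_sum_cong:
  assumes "p > 0" "[b = c] (mod p)"
  shows "exp_sum p G b = exp_sum p G c"
  unfolding exp_sum_def
  by (intro sum.cong refl unit_char_cong assms cong_scalar_right)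

lemma norm_exp_sum_0: "norm (exp_sum p G 0) = card G"
  by (simp add: exp_sum_def unit_char_def)

lemma exp_sum_fourth_moment:
  assumes p: "p > 0" and G: "finite G"
  shows "(\<Sum>b\<in>{0..<p}. norm (exp_sum p G b) ^ 4) = real_of_int p * real (energy_mod p G)"
proof -
  let ?P = "G \<times> G"
  let ?d = "\<lambda>q :: int \<times> int. fst q - snd q"
  have sq: "complex_of_real (norm (exp_sum p G b) ^ 2) = (\<Sum>q\<in>?P. unit_char p (b * ?d q))" for b
  proof -
    have "complex_of_real (norm (exp_sum p G b) ^ 2) = exp_sum p G b * cnj (exp_sum p G b)"
      by (simp only: complex_norm_square)
    also have "\<dots> = (\<Sum>x\<in>G. \<Sum>y\<in>G. unit_char p (b * (x - y)))"
      by (simp add: exp_sum_def sum_product cnj_unit_char algebra_simps flip: unit_char_add)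
    finally show ?thesis by (simp add: sum.cartesian_product case_prod_unfold)
  qed
  have "complex_of_real (\<Sum>b\<in>{0..<p}. norm (exp_sum p G b) ^ 4) =
      (\<Sum>b\<in>{0..<p}. complex_of_real (norm (exp_sum p G b) ^ 2) * cnj (complex_of_real (norm (exp_sum p G b) ^ 2)))"
    by (simp flip: power_add)
  also have "\<dots> = (\<Sum>b\<in>{0..<p}. \<Sum>q\<in>?P. \<Sum>r\<in>?P. unit_char p (b * (?d q - ?d r)))"
    unfolding sq
    by (simp add: sum_product cnj_unit_char flip: unit_char_add) (simp add: algebra_simps)
  also have "\<dots> = (\<Sum>q\<in>?P. \<Sum>b\<in>{0..<p}. \<Sum>r\<in>?P. unit_char p (b * (?d q - ?d r)))"
    by (rule sum.swap)
  also have "\<dots> = (\<Sum>q\<in>?P. \<Sum>r\<in>?P. \<Sum>b\<in>{0..<p}. unit_char p (b * (?d q - ?d r)))"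
    by (rule sum.cong[OF refl], rule sum.swap)
  also have "\<dots> = (\<Sum>q\<in>?P. \<Sum>r\<in>?P. if [?d q = ?d r] (mod p) then of_int p else 0)"
    unfolding sum_unit_char[OF p] cong_iff_dvd_diff ..
  also have "\<dots> = (\<Sum>z\<in>?P \<times> ?P. if [?d (fst z) = ?d (snd z)] (mod p) then of_int p else 0)"
    by (simp add: sum.cartesian_product case_prod_unfold)
  also have "\<dots> = of_nat (card {z \<in> ?P \<times> ?P. [?d (fst z) = ?d (snd z)] (mod p)}) * of_int p"
    using G by (subst sum.If_cases) (auto simp: Int_def)
  also have "{z \<in> ?P \<times> ?P. [?d (fst z) = ?d (snd z)] (mod p)} =
      {(q, r) \<in> ?P \<times> ?P. [?d q = ?d r] (mod p)}"
    by auto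
  finally have "complex_of_real (\<Sum>b\<in>{0..<p}. norm (exp_sum p G b) ^ 4) =
      complex_of_real (real_of_int p * real (energy_mod p G))"
    by (simp add: energy_mod_def mult.commute)
  then show ?thesis by (simp only: of_real_eq_iff)
qed

section \<open>Invariance under the subgroup and averages over sparse sets\<close>

lemma exp_sum_unity_roots_mult:
  assumes p: "p > 0" and t: "t > 0" and h: "h \<in> unity_roots_mod p t"
  shows "exp_sum p (unity_roots_mod p t) (b * h) = exp_sum p (unity_roots_mod p t) b"
proof -
  let ?G = "unity_roots_mod p t"
  let ?f = "\<lambda>g. h * g mod p"
  have inj: "inj_on ?f ?G"
  proof (rule inj_onI)
    fix x y assume xy: "x \<in> ?G" "y \<in> ?G" and "h * x mod p = h * y mod p"
    then have "[x = y] (mod p)"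
      using coprime_unity_root_mod[OF t h] by (simp add: cong_mult_lcancel flip: cong_def)
    then show "x = y"
      using xy eq_if_dvd_diff_residues by (auto simp: unity_roots_mod_def cong_iff_dvd_diff)
  qed
  have "?f ` ?G \<subseteq> ?G"
  proof safe
    fix g assume g: "g \<in> ?G"
    have "[(h * g) ^ t = 1 * 1] (mod p)"
      unfolding power_mult_distrib by (rule cong_mult) (use g h in \<open>auto simp: unity_roots_mod_def\<close>)
    then show "h * g mod p \<in> ?G"
      using p by (simp add: unity_roots_mod_def cong_def power_mod)
  qed
  then have im: "?f ` ?G = ?G"
    using inj by (intro endo_inj_surj) auto
  have "exp_sum p ?G b = (\<Sum>g\<in>?f ` ?G. unit_char p (b * g))"
    unfolding im exp_sum_def ..
  also have "\<dots> = (\<Sum>g\<in>?G. unit_char p (b * (h * g mod p)))"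
    by (subst sum.reindex[OF inj]) simp
  also have "\<dots> = exp_sum p ?G (b * h)"
    unfolding exp_sum_def
    by (intro sum.cong refl unit_char_cong p) (simp add: cong_def mod_mult_right_eq mult.assoc)
  finally show ?thesis by simp
qed

text \<open>Invariance of the sums under the group spreads each \<open>r\<close> over a coset; the fourth moment then
  loses only the number of \<open>r\<close> that share a coset.\<close>

lemma exp_sum_fourth_moment_sparse:
  assumes p: "prime p" and t: "t > 0" and a: "coprime a p" and T: "T \<subseteq> {0..<p}" "\<And>r. r \<in> T \<Longrightarrow> coprime r p"
    and K: "\<And>z. real (card {r \<in> T. [r ^ t = z] (mod p)}) \<le> K"
  shows "real (card (unity_roots_mod p t)) * (\<Sum>r\<in>T. norm (exp_sum p (unity_roots_mod p t) (r * a)) ^ 4) \<le>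
    K * (real_of_int p * real (energy_mod p (unity_roots_mod p t)))"
proof -
  let ?G = "unity_roots_mod p t"
  let ?F = "\<lambda>b. norm (exp_sum p ?G b) ^ 4"
  let ?f = "\<lambda>(r, h). r * a * h mod p"
  have p0: "p > 0" using p prime_gt_0_int by blast
  have finT: "finite T" using T(1) finite_subset by blast
  have F: "?F (r * a * h mod p) = ?F (r * a)" if "h \<in> ?G" for r h
  proof -
    have "exp_sum p ?G (r * a * h mod p) = exp_sum p ?G (r * a * h)"
      by (intro exp_sum_cong p0) simp
    then show ?thesis using exp_sum_unity_roots_mult[OF p0 t that] by simp
  qed
  \<comment> \<open>If r a h = r0 a h0, taking t-th powers removes h, h0 and the unit a, so r and r0
    have the same t-th power and K bounds the choices of r. Then r determines h.\<close>
  have fibre: "real (card {x \<in> T \<times> ?G. ?f x = b}) \<le> K" for b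
  proof (cases "{x \<in> T \<times> ?G. ?f x = b} = {}")
    case False
    then obtain r0 h0 where 0: "r0 \<in> T" "h0 \<in> ?G" "r0 * a * h0 mod p = b" by auto
    have "card {x \<in> T \<times> ?G. ?f x = b} \<le> card {r \<in> T. [r ^ t = r0 ^ t] (mod p)}"
    proof (rule card_inj_on_le[of fst])
      show "inj_on fst {x \<in> T \<times> ?G. ?f x = b}"
      proof (rule inj_onI)
        fix x y assume xy: "x \<in> {x \<in> T \<times> ?G. ?f x = b}" "y \<in> {x \<in> T \<times> ?G. ?f x = b}" "fst x = fst y"
        then obtain r h h' where x: "x = (r, h)" "y = (r, h')" by (metis prod.collapse)
        have "[r * a * h = r * a * h'] (mod p)" using xy x by (auto simp: cong_def)
        moreover have "coprime (r * a) p" using xy x T(2) a by auto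
        ultimately have "[h = h'] (mod p)" by (simp add: cong_mult_lcancel)
        then have "h = h'"
          using xy x eq_if_dvd_diff_residues by (auto simp: unity_roots_mod_def cong_iff_dvd_diff)
        then show "x = y" using x by simp
      qed
      show "fst ` {x \<in> T \<times> ?G. ?f x = b} \<subseteq> {r \<in> T. [r ^ t = r0 ^ t] (mod p)}"
      proof safe
        fix r h assume rh: "r \<in> T" "h \<in> ?G" "b = r * a * h mod p"
        have pw: "[(s * a * g) ^ t = a ^ t * s ^ t] (mod p)" if "g \<in> ?G" for s g
        proof -
          have "[g ^ t = 1] (mod p)" using that by (simp add: unity_roots_mod_def)
          then have "[a ^ t * s ^ t * g ^ t = a ^ t * s ^ t * 1] (mod p)" by (rule cong_scalar_left)
          then show ?thesis by (simp add: power_mult_distrib mult_ac)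
        qed
        have "[r * a * h = r0 * a * h0] (mod p)" using rh 0 by (simp add: cong_def)
        then have "[(r * a * h) ^ t = (r0 * a * h0) ^ t] (mod p)" by (rule cong_pow)
        then have "[a ^ t * r ^ t = a ^ t * r0 ^ t] (mod p)"
          using pw[OF rh(2), of r] pw[OF 0(2), of r0] by (metis cong_sym cong_trans)
        moreover have "coprime (a ^ t) p" using a by simp
        ultimately show "[fst (r, h) ^ t = r0 ^ t] (mod p)" by (simp add: cong_mult_lcancel)
      qed simp
    qed (use finT in simp)
    with K show ?thesis by (meson of_nat_le_iff order_trans)
  next
    case True
    then have "real (card {x \<in> T \<times> ?G. ?f x = b}) = 0" by (simp only: card.empty of_nat_0)
    also have "\<dots> \<le> K" using K[of 0] by (rule order_trans[rotated]) simp
    finally show ?thesis .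
  qed
  have "real (card ?G) * (\<Sum>r\<in>T. ?F (r * a)) = (\<Sum>r\<in>T. \<Sum>h\<in>?G. ?F (r * a))"
    by (simp add: sum_distrib_left)
  also have "\<dots> = (\<Sum>r\<in>T. \<Sum>h\<in>?G. ?F (r * a * h mod p))"
    by (intro sum.cong refl) (simp only: F)
  also have "\<dots> = (\<Sum>x\<in>T \<times> ?G. ?F (?f x))"
    by (simp add: sum.cartesian_product case_prod_unfold)
  also have "\<dots> = (\<Sum>b\<in>{0..<p}. \<Sum>x\<in>{x \<in> T \<times> ?G. ?f x = b}. ?F (?f x))"
    by (rule sum.group[symmetric]) (use finT p0 in auto)
  also have "\<dots> \<le> (\<Sum>b\<in>{0..<p}. K * ?F b)"
  proof (rule sum_mono)
    fix b
    have "(\<Sum>x\<in>{x \<in> T \<times> ?G. ?f x = b}. ?F (?f x)) = (\<Sum>x\<in>{x \<in> T \<times> ?G. ?f x = b}. ?F b)"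
      by (rule sum.cong) blast+
    also have "\<dots> = real (card {x \<in> T \<times> ?G. ?f x = b}) * ?F b" by (simp only: sum_constant)
    also have "\<dots> \<le> K * ?F b"
      by (rule mult_right_mono[OF fibre]) simp
    finally show "(\<Sum>x\<in>{x \<in> T \<times> ?G. ?f x = b}. ?F (?f x)) \<le> K * ?F b" .
  qed
  also have "\<dots> = K * (\<Sum>b\<in>{0..<p}. ?F b)" by (simp add: sum_distrib_left)
  also have "(\<Sum>b\<in>{0..<p}. ?F b) = real_of_int p * real (energy_mod p ?G)"
    by (rule exp_sum_fourth_moment) (use p0 in auto)
  finally show ?thesis .
qed

text \<open>Hoelder's inequality for exponent 4, obtained from Cauchy-Schwarz applied twice.\<close>

lemma sum_fourth_power_le:
  fixes f :: "'a \<Rightarrow> real"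
  assumes "finite T"
  shows "(\<Sum>r\<in>T. f r) ^ 4 \<le> real (card T) ^ 3 * (\<Sum>r\<in>T. f r ^ 4)"
proof -
  have CS: "(\<Sum>r\<in>T. g r) ^ 2 \<le> real (card T) * (\<Sum>r\<in>T. g r ^ 2)" for g :: "'a \<Rightarrow> real"
    using sum_squared_le_sum_of_squares[of g T] assms by (simp add: mult.commute)
  have "(\<Sum>r\<in>T. f r) ^ 4 = ((\<Sum>r\<in>T. f r) ^ 2) ^ 2" by (simp flip: power_mult)
  also have "\<dots> \<le> (real (card T) * (\<Sum>r\<in>T. f r ^ 2)) ^ 2"
    by (intro power_mono CS) simp
  also have "\<dots> = real (card T) ^ 2 * (\<Sum>r\<in>T. f r ^ 2) ^ 2" by (simp add: power_mult_distrib)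
  also have "\<dots> \<le> real (card T) ^ 2 * (real (card T) * (\<Sum>r\<in>T. (f r ^ 2) ^ 2))"
    by (intro mult_left_mono CS) simp
  also have "(\<Sum>r\<in>T. (f r ^ 2) ^ 2) = (\<Sum>r\<in>T. f r ^ 4)" by (simp flip: power_mult)
  also have "real (card T) ^ 2 * (real (card T) * (\<Sum>r\<in>T. f r ^ 4)) =
      real (card T) ^ 3 * (\<Sum>r\<in>T. f r ^ 4)"
    by (simp add: power2_eq_square power3_eq_cube)
  finally show ?thesis .
qed

text \<open>The Fejer kernel \<open>|\<Sum>j<R. e(j x)|^2\<close> is nonnegative everywhere and at least \<open>R^2/4\<close> at
  residues \<open>y\<close> with \<open>6 y (R - 1) \<le> p\<close>, where every term has real part at least \<open>1/2\<close>.\<close>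

lemma card_short_residues_le_exp_sums:
  assumes p: "p > 0" and G: "finite G" and U: "U \<subseteq> G" and R: "R > 0"
    and y: "\<And>g. g \<in> U \<Longrightarrow> \<exists>y\<ge>0. [y = a * g] (mod p) \<and> 6 * y * (int R - 1) \<le> p"
  shows "real (card U) * real R \<le>
    4 * (real (card G) + 2 * (\<Sum>r\<in>{1..<int R}. norm (exp_sum p G (r * a))))"
proof -
  define f where "f = (\<lambda>r. norm (exp_sum p G (r * a)))"
  define D where "D = (\<lambda>n. \<Sum>j<R. unit_char p (int j * n))"
  have fneg: "f (- r) = f r" for r
    using exp_sum_uminus[of p G "r * a"] by (simp add: f_def)
  have low: "(real R / 2) ^ 2 \<le> norm (D (a * g)) ^ 2" if g: "g \<in> U" for g
  proof -
    obtain y where y: "y \<ge> 0" "[y = a * g] (mod p)" "6 * y * (int R - 1) \<le> p"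
      using y[OF g] by blast
    have "1 / 2 \<le> Re (unit_char p (int j * (a * g)))" if j: "j < R" for j
    proof -
      have "[int j * (a * g) = int j * y] (mod p)" using cong_scalar_left[OF cong_sym[OF y(2)]] .
      then have "unit_char p (int j * (a * g)) = unit_char p (int j * y)" by (rule unit_char_cong[OF p])
      moreover have "1 / 2 \<le> Re (unit_char p (int j * y))"
      proof -
        have "int j * y \<le> (int R - 1) * y" using j y(1) by (intro mult_right_mono) auto
        then have "6 * (int j * y) \<le> p" using y(3) by (simp add: algebra_simps)
        then have "6 * real_of_int (int j * y) \<le> real_of_int p"
          by (metis of_int_le_iff of_int_mult of_int_numeral)
        then have "2 * pi * (real_of_int (int j * y) / real_of_int p) \<le> pi / 3"
          using p by (simp add: field_simps)
        moreover have "0 \<le> 2 * pi * (real_of_int (int j * y) / real_of_int p)"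
          using y(1) p by simp
        ultimately have "cos (pi / 3) \<le> cos (2 * pi * (real_of_int (int j * y) / real_of_int p))"
          by (intro cos_monotone_0_pi_le) auto
        then show ?thesis by (simp add: unit_char_def cos_60)
      qed
      ultimately show ?thesis by simp
    qed
    then have "(\<Sum>j<R. 1 / 2) \<le> (\<Sum>j<R. Re (unit_char p (int j * (a * g))))"
      by (intro sum_mono) auto
    then have "real R / 2 \<le> Re (D (a * g))" by (simp add: D_def)
    also have "\<dots> \<le> norm (D (a * g))" by (rule complex_Re_le_cmod)
    finally show ?thesis by (intro power_mono) auto
  qed
  \<comment> \<open>For fixed k the differences j - k are distinct and lie strictly between -R and
    R. Conjugation folds the negative ones onto the positive ones, and the difference 0 contributes
    |G|.\<close>
  have row: "(\<Sum>j<R. f (int j - int k)) \<le> real (card G) + 2 * (\<Sum>r\<in>{1..<int R}. f r)" if k: "k < R" for k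
  proof -
    have "{..<R} = {..<k} \<union> insert k {k<..<R}" using k by auto
    moreover have "(\<Sum>j\<in>{..<k} \<union> insert k {k<..<R}. g j) =
        (\<Sum>j<k. g j) + (g k + (\<Sum>j\<in>{k<..<R}. g j))" for g :: "nat \<Rightarrow> real"
      by (subst sum.union_disjoint) auto
    ultimately have "(\<Sum>j<R. f (int j - int k)) =
        (\<Sum>j<k. f (int j - int k)) + (f 0 + (\<Sum>j\<in>{k<..<R}. f (int j - int k)))"
      by simp
    also have "(\<Sum>j<k. f (int j - int k)) = (\<Sum>j<k. f (int k - int j))"
      by (rule sum.cong[OF refl]) (metis fneg minus_diff_eq)
    also have "(\<Sum>j<k. f (int k - int j)) = sum f ((\<lambda>j. int k - int j) ` {..<k})"
      by (subst sum.reindex) (auto simp: inj_on_def)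
    also have "\<dots> \<le> (\<Sum>r\<in>{1..<int R}. f r)"
      by (intro sum_mono2) (use k in \<open>auto simp: f_def\<close>)
    also have "(\<Sum>j\<in>{k<..<R}. f (int j - int k)) = sum f ((\<lambda>j. int j - int k) ` {k<..<R})"
      by (subst sum.reindex) (auto simp: inj_on_def)
    also have "\<dots> \<le> (\<Sum>r\<in>{1..<int R}. f r)"
      by (intro sum_mono2) (auto simp: f_def)
    also have "f 0 = real (card G)" by (simp add: f_def norm_exp_sum_0)
    finally show ?thesis by simp
  qed
  have "complex_of_real (\<Sum>g\<in>G. norm (D (a * g)) ^ 2) =
      (\<Sum>g\<in>G. \<Sum>k<R. \<Sum>j<R. unit_char p ((int j - int k) * a * g))"
  proof -
    have "complex_of_real (norm (D n) ^ 2) = (\<Sum>k<R. \<Sum>j<R. unit_char p ((int j - int k) * n))" for n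
    proof -
      have "complex_of_real (norm (D n) ^ 2) = cnj (D n) * D n"
        by (simp only: complex_norm_square mult.commute)
      then show ?thesis
        unfolding D_def cnj_sum sum_product cnj_unit_char
        by (simp add: left_diff_distrib flip: unit_char_add)
    qed
    then show ?thesis by (simp add: mult.assoc)
  qed
  also have "\<dots> = (\<Sum>k<R. \<Sum>g\<in>G. \<Sum>j<R. unit_char p ((int j - int k) * a * g))"
    by (rule sum.swap)
  also have "\<dots> = (\<Sum>k<R. \<Sum>j<R. exp_sum p G ((int j - int k) * a))"
    unfolding exp_sum_def by (rule sum.cong[OF refl], rule sum.swap)
  finally have "complex_of_real (\<Sum>g\<in>G. norm (D (a * g)) ^ 2) =
      (\<Sum>k<R. \<Sum>j<R. exp_sum p G ((int j - int k) * a))" .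
  then have "norm (complex_of_real (\<Sum>g\<in>G. norm (D (a * g)) ^ 2)) =
      norm (\<Sum>k<R. \<Sum>j<R. exp_sum p G ((int j - int k) * a))"
    by (rule arg_cong)
  moreover have "0 \<le> (\<Sum>g\<in>G. norm (D (a * g)) ^ 2)" by (intro sum_nonneg) simp
  ultimately have "(\<Sum>g\<in>G. norm (D (a * g)) ^ 2) = norm (\<Sum>k<R. \<Sum>j<R. exp_sum p G ((int j - int k) * a))"
    by (simp only: norm_of_real abs_of_nonneg)
  also have "\<dots> \<le> (\<Sum>k<R. \<Sum>j<R. f (int j - int k))"
    unfolding f_def by (rule order_trans[OF norm_sum sum_mono[OF norm_sum]])
  also have "\<dots> \<le> (\<Sum>k<R. real (card G) + 2 * (\<Sum>r\<in>{1..<int R}. f r))"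
    by (intro sum_mono row) auto
  finally have "(\<Sum>g\<in>G. norm (D (a * g)) ^ 2) \<le> real R * (real (card G) + 2 * (\<Sum>r\<in>{1..<int R}. f r))"
    by simp
  moreover have "real (card U) * (real R / 2) ^ 2 \<le> (\<Sum>g\<in>G. norm (D (a * g)) ^ 2)"
  proof -
    have "real (card U) * (real R / 2) ^ 2 = (\<Sum>g\<in>U. (real R / 2) ^ 2)" by simp
    also have "\<dots> \<le> (\<Sum>g\<in>U. norm (D (a * g)) ^ 2)" by (intro sum_mono low)
    also have "\<dots> \<le> (\<Sum>g\<in>G. norm (D (a * g)) ^ 2)" using U G by (intro sum_mono2) auto
    finally show ?thesis .
  qed
  ultimately have "real (card U) * (real R / 2) ^ 2 \<le>
      real R * (real (card G) + 2 * (\<Sum>r\<in>{1..<int R}. f r))" by linarith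
  then have "real R * (real (card U) * real R) \<le>
      real R * (4 * (real (card G) + 2 * (\<Sum>r\<in>{1..<int R}. f r)))"
    by (simp add: power2_eq_square algebra_simps)
  then show ?thesis using R by (simp add: f_def)
qed

section \<open>Divisors and products in cosets\<close>

definition ndiv :: "nat \<Rightarrow> nat" where
  "ndiv n = card {d. d dvd n}"

lemma ndiv_mult_le:
  assumes "a > 0" "b > 0"
  shows "ndiv (a * b) \<le> ndiv a * ndiv b"
proof -
  have "{d. d dvd a * b} \<subseteq> (\<lambda>(x, y). x * y) ` ({d. d dvd a} \<times> {d. d dvd b})"
    using division_decomp[of _ a b] by force
  then have "ndiv (a * b) \<le> card ((\<lambda>(x, y). x * y) ` ({d. d dvd a} \<times> {d. d dvd b}))"
    unfolding ndiv_def using assms by (intro card_mono) auto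
  also have "\<dots> \<le> card ({d. d dvd a} \<times> {d. d dvd b})"
    using assms by (intro card_image_le) auto
  finally show ?thesis by (simp add: ndiv_def card_cartesian_product)
qed

lemma ndiv_prime_power_le:
  assumes "prime q"
  shows "ndiv (q ^ e) \<le> e + 1"
proof -
  have "{d. d dvd q ^ e} \<subseteq> (\<lambda>i. q ^ i) ` {..e}"
    using assms by (auto simp: divides_primepow_nat)
  then have "ndiv (q ^ e) \<le> card ((\<lambda>i. q ^ i) ` {..e})"
    unfolding ndiv_def by (intro card_mono) auto
  also have "\<dots> \<le> card {..e}" by (rule card_image_le) simp
  finally show ?thesis by simp
qed

text \<open>Only the primes \<open>q < 2^(1/\<epsilon>)\<close> can contribute a factor exceeding \<open>q^(\<epsilon> e)\<close>, and each
  of them at most a bounded one.\<close>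

lemma ndiv_bound:
  fixes \<epsilon> :: real
  assumes \<epsilon>: "\<epsilon> > 0"
  shows "\<exists>C\<ge>1. \<forall>n>0. real (ndiv n) \<le> C * real n powr \<epsilon>"
proof -
  \<comment> \<open>Beyond Q a prime satisfies q^\<epsilon> >= 2, so q^(\<epsilon> e) >= 2^e already
    dominates the e + 1 divisors of q^e.\<close>
  define Q where "Q = nat \<lceil>2 powr (1 / \<epsilon>)\<rceil>"
  \<comment> \<open>Chosen so that e + 1 <= c (1 + \<epsilon> e ln 2), after which 1 + x <= exp x
    gives e + 1 <= c 2^(\<epsilon> e).\<close>
  define c where "c = 1 + 1 / (\<epsilon> * ln 2)"
  have c1: "c \<ge> 1" using \<epsilon> by (simp add: c_def)
  have Q: "2 \<le> real q powr \<epsilon>" if "Q \<le> q" for q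
  proof -
    have "2 powr (1 / \<epsilon>) \<le> real q" using that by (simp add: Q_def nat_le_iff ceiling_le_iff)
    then have "(2 powr (1 / \<epsilon>)) powr \<epsilon> \<le> real q powr \<epsilon>" using \<epsilon> by (intro powr_mono2) auto
    then show ?thesis using \<epsilon> by (simp add: powr_powr)
  qed
  have c: "real e + 1 \<le> c * 2 powr (\<epsilon> * real e)" for e :: nat
  proof -
    have "real e + 1 \<le> c * (1 + \<epsilon> * real e * ln 2)"
      using \<epsilon> by (simp add: c_def field_simps)
    also have "\<dots> \<le> c * exp (\<epsilon> * real e * ln 2)"
      using c1 by (intro mult_left_mono) auto
    finally show ?thesis by (simp add: powr_def)
  qed
  let ?S = "\<lambda>n. {q. prime q \<and> q dvd n \<and> q < Q}"
  have main: "real (ndiv n) \<le> c ^ card (?S n) * real n powr \<epsilon>" if "n > 0" for n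
    using that
  proof (induction n rule: less_induct)
    case (less n)
    show ?case
    proof (cases "n = 1")
      case True
      have "?S (1 :: nat) = {}" by auto
      then have "card (?S n) = 0" unfolding True by (simp only: card.empty)
      moreover have "real (ndiv n) = 1" using True by (simp add: ndiv_def)
      moreover have "real n powr \<epsilon> = 1" using True by simp
      ultimately show ?thesis by (simp only: power_0)
    next
      case False
      then obtain q where q: "prime q" "q dvd n" using prime_factor_nat by blast
      define e where "e = multiplicity q n"
      have "n \<noteq> 0" "\<not> is_unit q" using less.prems q(1) not_prime_unit by auto
      from multiplicity_decompose'[OF this] obtain m where n: "n = q ^ e * m" and qm: "\<not> q dvd m"
        unfolding e_def by blast
      have e: "e > 0" using q less.prems by (simp add: e_def prime_multiplicity_gt_zero_iff)
      have m: "m > 0" using n less.prems by (cases m) auto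
      have dvd_n: "r dvd n \<longleftrightarrow> r = q \<or> r dvd m" if "prime r" for r
        using that q(1) e primes_dvd_imp_eq[of r q]
        by (auto simp: n prime_dvd_mult_iff prime_dvd_power_iff)
      have q2: "q \<ge> 2" using q prime_ge_2_nat by blast
      have "1 < q ^ e" using q2 e by (intro one_less_power) auto
      then have mn: "m < n" unfolding n using m by simp
      have "ndiv n \<le> ndiv (q ^ e) * ndiv m"
        unfolding n using q2 m by (intro ndiv_mult_le) auto
      also have "\<dots> \<le> (e + 1) * ndiv m"
        by (intro mult_le_mono1 ndiv_prime_power_le q)
      finally have "real (ndiv n) \<le> (real e + 1) * real (ndiv m)"
        using of_nat_mono[of "ndiv n" "(e + 1) * ndiv m"] by (simp add: algebra_simps)
      also have "\<dots> \<le> (real e + 1) * (c ^ card (?S m) * real m powr \<epsilon>)"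
        by (intro mult_left_mono less.IH mn m) auto
      also have "\<dots> \<le> c ^ card (?S n) * real n powr \<epsilon>"
      proof -
        have np: "real n powr \<epsilon> = (real q powr \<epsilon>) ^ e * real m powr \<epsilon>"
          using q2 m by (simp add: n powr_mult powr_power flip: powr_realpow) (simp add: powr_powr mult.commute)
        show ?thesis
        proof (cases "q < Q")
          case True
          have "?S n = insert q (?S m)"
            using q True dvd_n by auto
          then have cn: "card (?S n) = Suc (card (?S m))" using qm by simp
          have "2 powr (\<epsilon> * real e) \<le> (real q powr \<epsilon>) ^ e"
            using q2 \<epsilon> powr_mono2[of "\<epsilon> * real e" 2 "real q"]
            by (simp add: powr_power mult.commute)
          then have "c * 2 powr (\<epsilon> * real e) \<le> c * (real q powr \<epsilon>) ^ e"
            using c1 by (intro mult_left_mono) auto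
          with c[of e] have "real e + 1 \<le> c * (real q powr \<epsilon>) ^ e" by linarith
          then have "(real e + 1) * (c ^ card (?S m) * real m powr \<epsilon>) \<le>
              (c * (real q powr \<epsilon>) ^ e) * (c ^ card (?S m) * real m powr \<epsilon>)"
            using c1 by (intro mult_right_mono) auto
          then show ?thesis by (simp add: np cn mult_ac)
        next
          case False
          have "?S n = ?S m"
            using q False dvd_n by auto
          moreover have "real e + 1 \<le> (real q powr \<epsilon>) ^ e"
          proof -
            have "e + 1 \<le> 2 ^ e" unfolding Suc_eq_plus1[symmetric] by (rule Suc_leI[OF less_exp])
            then have "real (e + 1) \<le> real (2 ^ e)" by (rule of_nat_mono)
            then have "real e + 1 \<le> 2 ^ e" by simp
            also have "\<dots> \<le> (real q powr \<epsilon>) ^ e" using Q False by (intro power_mono) auto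
            finally show ?thesis .
          qed
          then have "(real e + 1) * (c ^ card (?S m) * real m powr \<epsilon>) \<le>
              (real q powr \<epsilon>) ^ e * (c ^ card (?S m) * real m powr \<epsilon>)"
            using c1 by (intro mult_right_mono) auto
          ultimately show ?thesis by (simp add: np mult_ac)
        qed
      qed
      finally show ?thesis .
    qed
  qed
  have "real (ndiv n) \<le> c ^ Q * real n powr \<epsilon>" if "n > 0" for n
  proof -
    have "card (?S n) \<le> card {..<Q}" by (intro card_mono) auto
    then have "c ^ card (?S n) \<le> c ^ Q" using c1 by (intro power_increasing) auto
    then have "c ^ card (?S n) * real n powr \<epsilon> \<le> c ^ Q * real n powr \<epsilon>" by (intro mult_right_mono) auto
    with main[OF that] show ?thesis by linarith
  qed
  moreover have "c ^ Q \<ge> 1" using c1 by (rule one_le_power)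
  ultimately show ?thesis by blast
qed

section \<open>Multiplying elements with prescribed d-th powers\<close>

lemma card_roots_power_mod_upto_le:
  fixes p t N :: nat
  assumes p: "prime p" and t: "t > 0"
  shows "card {n \<in> {1..N}. [int n ^ t = z] (mod int p)} \<le> t * (N div p + 1)"
proof -
  let ?A = "{x \<in> {0..<int p}. [x ^ t = z] (mod int p)}"
  have p0: "p > 0" using p prime_gt_0_nat by blast
  have "card {n \<in> {1..N}. [int n ^ t = z] (mod int p)} \<le> card (?A \<times> {0..N div p})"
  proof (rule card_inj_on_le[of "\<lambda>n. (int n mod int p, n div p)"])
    show "inj_on (\<lambda>n. (int n mod int p, n div p)) {n \<in> {1..N}. [int n ^ t = z] (mod int p)}"
    proof (rule inj_onI)
      fix m n assume "(int m mod int p, m div p) = (int n mod int p, n div p)"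
      then have "m mod p = n mod p" "m div p = n div p" by (auto simp flip: of_nat_mod)
      then show "m = n" by (metis div_mult_mod_eq)
    qed
    show "(\<lambda>n. (int n mod int p, n div p)) ` {n \<in> {1..N}. [int n ^ t = z] (mod int p)} \<subseteq> ?A \<times> {0..N div p}"
      using p0 by (auto simp: cong_def power_mod div_le_mono)
  qed auto
  also have "\<dots> = card ?A * (N div p + 1)" by (simp add: card_cartesian_product)
  also have "\<dots> \<le> t * (N div p + 1)"
    using card_roots_power_mod_le[of "int p" t z] p t by (intro mult_le_mono1) auto
  finally show ?thesis .
qed

text \<open>Products of three elements again have a fixed \<open>t\<close>-th power, and a product has few
  factorisations.\<close>

lemma card_prod3_coset_le:
  fixes p t T :: nat and X1 X2 X3 :: "nat set"
  assumes p: "prime p" and t: "t > 0"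
    and X: "X1 \<subseteq> {1..N1}" "X2 \<subseteq> {1..N2}" "X3 \<subseteq> {1..N3}"
    and z: "\<And>x. x \<in> X1 \<Longrightarrow> [int x ^ t = z1] (mod int p)"
      "\<And>x. x \<in> X2 \<Longrightarrow> [int x ^ t = z2] (mod int p)" "\<And>x. x \<in> X3 \<Longrightarrow> [int x ^ t = z3] (mod int p)"
    and T: "\<And>n. 1 \<le> n \<Longrightarrow> n \<le> N1 * N2 * N3 \<Longrightarrow> ndiv n \<le> T"
  shows "card X1 * card X2 * card X3 \<le> T ^ 3 * (t * (N1 * N2 * N3 div p + 1))"
proof -
  let ?f = "\<lambda>(x, y, z). x * y * z :: nat"
  let ?X = "X1 \<times> X2 \<times> X3"
  let ?S = "{n \<in> {1..N1 * N2 * N3}. [int n ^ t = z1 * z2 * z3] (mod int p)}"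
  have fin: "finite X1" "finite X2" "finite X3" using X finite_subset by blast+
  have im: "?f ` ?X \<subseteq> ?S"
  proof
    fix n assume "n \<in> ?f ` ?X"
    then obtain x y w where xyw: "x \<in> X1" "y \<in> X2" "w \<in> X3" "n = x * y * w" by auto
    have r: "1 \<le> x" "x \<le> N1" "1 \<le> y" "y \<le> N2" "1 \<le> w" "w \<le> N3" using xyw X by auto
    then have "n \<le> N1 * N2 * N3" unfolding xyw(4) by (intro mult_le_mono) auto
    moreover have "1 \<le> n" using r by (simp add: xyw(4) Suc_leI)
    moreover have "[int n ^ t = z1 * z2 * z3] (mod int p)"
      unfolding xyw(4) of_nat_mult power_mult_distrib by (intro cong_mult z xyw)
    ultimately show "n \<in> ?S" by simp
  qed
  have fibre: "card {x \<in> ?X. ?f x = n} \<le> T ^ 3" if n: "n \<in> ?S" for n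
  proof -
    have n1: "n \<ge> 1" "n \<le> N1 * N2 * N3" using n by auto
    have "{x \<in> ?X. ?f x = n} \<subseteq> {d. d dvd n} \<times> {d. d dvd n} \<times> {d. d dvd n}" by auto
    then have "card {x \<in> ?X. ?f x = n} \<le> card ({d. d dvd n} \<times> {d. d dvd n} \<times> {d. d dvd n})"
      using n1 by (intro card_mono) auto
    also have "\<dots> = ndiv n ^ 3" by (simp add: card_cartesian_product ndiv_def power3_eq_cube)
    also have "\<dots> \<le> T ^ 3" using T[OF n1] by (intro power_mono) auto
    finally show ?thesis .
  qed
  have "card X1 * card X2 * card X3 = card ?X" by (simp add: card_cartesian_product)
  also have "\<dots> = (\<Sum>x\<in>?X. 1)" by simp
  also have "\<dots> = (\<Sum>n\<in>?S. \<Sum>x\<in>{x \<in> ?X. ?f x = n}. 1)"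
    by (rule sum.group[symmetric]) (use fin im in auto)
  also have "\<dots> = (\<Sum>n\<in>?S. card {x \<in> ?X. ?f x = n})" by simp
  also have "\<dots> \<le> (\<Sum>n\<in>?S. T ^ 3)" by (rule sum_mono[OF fibre])
  also have "\<dots> = T ^ 3 * card ?S" by simp
  also have "\<dots> \<le> T ^ 3 * (t * (N1 * N2 * N3 div p + 1))"
    by (intro mult_le_mono2 card_roots_power_mod_upto_le p t)
  finally show ?thesis .
qed

section \<open>Solutions of given order\<close>

lemma le_if_power_le:
  fixes a b :: real
  assumes "a ^ n \<le> b ^ n" "0 \<le> b" "n > 0"
  shows "a \<le> b"
  using assms power_strict_mono[of b a n] by (force simp: not_less[symmetric])

definition self_power_class :: "nat \<Rightarrow> nat \<Rightarrow> nat set" where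
  "self_power_class p d = {x \<in> {1..p - 1}. d dvd x \<and> ord p x = d}"

lemma finite_self_power_class [simp]: "finite (self_power_class p d)"
  by (simp add: self_power_class_def)

lemma J_1_le_sum_self_power_class:
  assumes p: "prime p"
  shows "J p 1 \<le> (\<Sum>d\<in>{d. d dvd p - 1}. card (self_power_class p d))"
proof -
  have p2: "p \<ge> 2" using p prime_ge_2_nat by blast
  have fin: "finite {d. d dvd p - 1}" using p2 by simp
  have "{x. 1 \<le> x \<and> x \<le> p - 1 \<and> [x ^ x = 1] (mod p)} \<subseteq> (\<Union>d\<in>{d. d dvd p - 1}. self_power_class p d)"
  proof safe
    fix x assume x: "1 \<le> x" "x \<le> p - 1" "[x ^ x = 1] (mod p)"
    have "\<not> p dvd x" using x p2 by (auto dest: dvd_imp_le)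
    then have "coprime p x" using p by (simp add: prime_imp_coprime)
    then have "ord p x dvd p - 1" using order_divides_totient[of p x] p by (simp add: totient_prime)
    moreover have "ord p x dvd x" using x(3) ord_divides by blast
    ultimately show "x \<in> (\<Union>d\<in>{d. d dvd p - 1}. self_power_class p d)"
      using x by (auto simp: self_power_class_def)
  qed
  then have "J p 1 \<le> card (\<Union>d\<in>{d. d dvd p - 1}. self_power_class p d)"
    unfolding J_def using fin by (intro card_mono) auto
  also have "\<dots> \<le> (\<Sum>d\<in>{d. d dvd p - 1}. card (self_power_class p d))"
    by (rule card_UN_le[OF fin])
  finally show ?thesis .
qed

text \<open>From (d y)^d = 1 with d invertible modulo p, the residue of y^d is forced to be d^(-d).
  It is named through one chosen quotient; for an empty class any z will do.\<close>

lemma self_power_class_quotients: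
  assumes p: "prime p" and d: "d > 0" "d < p"
  obtains Y z where "card Y = card (self_power_class p d)" "Y \<subseteq> {1..(p - 1) div d}"
    "\<And>y. y \<in> Y \<Longrightarrow> [int y ^ d = z] (mod int p)"
proof (cases "self_power_class p d = {}")
  case True
  then show ?thesis using that[of "{}" 0] by simp
next
  case False
  let ?A = "self_power_class p d"
  let ?q = "\<lambda>x. x div d"
  obtain x0 where x0: "x0 \<in> ?A" using False by blast
  have x: "x = d * ?q x" "1 \<le> x" "x \<le> p - 1" "[int d ^ d * int (?q x) ^ d = 1] (mod int p)" if "x \<in> ?A" for x
  proof -
    show 1: "x = d * ?q x" "1 \<le> x" "x \<le> p - 1" using that by (auto simp: self_power_class_def)
    have "[x ^ d = 1] (mod p)" unfolding ord_divides using that by (simp add: self_power_class_def)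
    then have "[int (x ^ d) = int 1] (mod int p)" by (simp only: cong_int_iff)
    then have "[int (d * ?q x) ^ d = 1] (mod int p)" using 1(1) by simp
    then show "[int d ^ d * int (?q x) ^ d = 1] (mod int p)" by (simp add: power_mult_distrib)
  qed
  have cop: "coprime (int d ^ d) (int p)"
  proof -
    have "\<not> p dvd d" using d by (auto dest: dvd_imp_le)
    then have "coprime p d" using p by (simp add: prime_imp_coprime)
    then have "coprime (int d) (int p)" by (simp add: coprime_commute)
    then show ?thesis by simp
  qed
  show ?thesis
  proof (rule that[of "?q ` ?A" "int (?q x0) ^ d"])
    show "card (?q ` ?A) = card ?A"
      by (intro card_image inj_onI) (metis x(1))
    show "?q ` ?A \<subseteq> {1..(p - 1) div d}"
    proof
      fix y assume "y \<in> ?q ` ?A"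
      then obtain u where u: "u \<in> ?A" "y = ?q u" by blast
      have "y \<noteq> 0" using x(1,2)[OF u(1)] u(2) by (metis mult_0_right not_one_le_zero)
      moreover have "y \<le> (p - 1) div d" unfolding u(2) using x(3)[OF u(1)] by (rule div_le_mono)
      ultimately show "y \<in> {1..(p - 1) div d}" by simp
    qed
    fix y assume "y \<in> ?q ` ?A"
    then obtain u where u: "u \<in> ?A" "y = ?q u" by blast
    have "[int d ^ d * int y ^ d = int d ^ d * int (?q x0) ^ d] (mod int p)"
      unfolding u(2) using x(4)[OF u(1)] x(4)[OF x0] by (metis cong_sym cong_trans)
    then show "[int y ^ d = int (?q x0) ^ d] (mod int p)"
      using cop by (simp add: cong_mult_lcancel)
  qed
qed

lemma self_power_class_subset_unity_roots:
  assumes p: "prime p"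
  shows "int ` self_power_class p d \<subseteq> unity_roots_mod (int p) d"
proof
  fix g assume "g \<in> int ` self_power_class p d"
  then obtain x where x: "x \<in> self_power_class p d" "g = int x" by blast
  have "[x ^ d = 1] (mod p)" unfolding ord_divides using x by (simp add: self_power_class_def)
  then have "[int (x ^ d) = int 1] (mod int p)" by (simp only: cong_int_iff)
  moreover have "x < p" using x by (auto simp: self_power_class_def)
  ultimately show "g \<in> unity_roots_mod (int p) d"
    by (simp add: unity_roots_mod_def x(2))
qed

lemma card_self_power_class_le:
  assumes p: "prime p" and d: "d > 0"
  shows "card (self_power_class p d) \<le> d"
proof -
  have "card (self_power_class p d) = card (int ` self_power_class p d)"
    by (simp add: card_image)
  also have "\<dots> \<le> card (unity_roots_mod (int p) d)"
    by (intro card_mono self_power_class_subset_unity_roots p) simp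
  also have "\<dots> \<le> d" using p d by (intro card_unity_roots_mod_le) auto
  finally show ?thesis .
qed

text \<open>A root count gives only the upper bound, since d need not divide p - 1 here; an element
  of order d supplies d distinct powers.\<close>

lemma card_unity_roots_mod_eq:
  assumes p: "prime p" and d: "d > 0" and x: "x \<in> self_power_class p d"
  shows "card (unity_roots_mod (int p) d) = d"
proof (rule antisym)
  show "card (unity_roots_mod (int p) d) \<le> d" using p d by (intro card_unity_roots_mod_le) auto
  have x': "ord p x = d" using x by (simp add: self_power_class_def)
  have cop: "coprime p x" using x' d by (metis ord_eq_0 less_irrefl)
  have "inj_on (\<lambda>k. int (x ^ k mod p)) {..<d}"
    using inj_power_mod[OF cop] unfolding x' inj_on_def of_nat_eq_iff .
  then have "d = card ((\<lambda>k. int (x ^ k mod p)) ` {..<d})"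
    by (simp add: card_image)
  also have "\<dots> \<le> card (unity_roots_mod (int p) d)"
  proof (intro card_mono image_subsetI)
    fix k
    have "[x ^ d = 1] (mod p)" unfolding ord_divides x' by simp
    then have "[(x ^ d) ^ k = 1 ^ k] (mod p)" by (rule cong_pow)
    then have "[(x ^ k) ^ d = 1] (mod p)" by (simp add: mult.commute flip: power_mult)
    then have "[(x ^ k mod p) ^ d = 1] (mod p)" by (simp add: cong_def power_mod)
    then have "[int ((x ^ k mod p) ^ d) = int 1] (mod int p)" by (simp only: cong_int_iff)
    moreover have "int (x ^ k mod p) < int p" using p prime_gt_0_nat[of p] by simp
    ultimately show "int (x ^ k mod p) \<in> unity_roots_mod (int p) d"
      by (simp add: unity_roots_mod_def)
  qed simp
  finally show "d \<le> card (unity_roots_mod (int p) d)" .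
qed

text \<open>With a = 1/d modulo p, each x in the class has a x congruent to the integer x/d <= p/d,
  so the class consists of group elements that a moves into a short interval. K bounds the number of
  r <= d in one coset, by the products of three such r. The witness X is the sum of |S(r a)| over 0
  < r < R divided by R; keeping its fourth power avoids extracting roots.\<close>

lemma card_self_power_class_fourier:
  fixes K :: real
  assumes p: "prime p" and d: "d > 0" "d < p" and dp: "d * d \<le> p"
    and T: "\<And>n. 1 \<le> n \<Longrightarrow> n \<le> p ^ 3 \<Longrightarrow> ndiv n \<le> T"
    and K: "K \<ge> 0" "real T ^ 3 * (real d * (real d ^ 3 / real p + 1)) \<le> K ^ 3"
  obtains X where "X \<ge> 0" "real (card (self_power_class p d)) \<le> 24 + 8 * X"
    "X ^ 4 \<le> 2154 * (K * real p * real d powr (1/2) * (1 + ln (real p)))"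
proof (cases "self_power_class p d = {}")
  case True
  then show ?thesis using that[of 0] K(1) prime_ge_1_nat[OF p] by simp
next
  case False
  then obtain x0 where x0: "x0 \<in> self_power_class p d" by blast
  let ?A = "self_power_class p d"
  let ?G = "unity_roots_mod (int p) d"
  let ?S = "exp_sum (int p) ?G"
  have p': "prime (int p)" and p0: "int p > 0" and p1: "real p \<ge> 1"
    using p prime_gt_0_nat[OF p] prime_ge_1_nat[OF p] by auto
  have cardG: "card ?G = d" by (rule card_unity_roots_mod_eq[OF p d(1) x0])
  have cop_lt: "coprime (int r) (int p)" if "0 < r" "r < p" for r
  proof -
    have "\<not> p dvd r" using that by (auto dest: dvd_imp_le)
    then show ?thesis using p by (simp add: coprime_commute prime_imp_coprime)
  qed
  obtain a where a: "[int d * a = 1] (mod int p)"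
    using cong_solve_coprime_int[OF cop_lt[OF d]] by blast
  then have cop_a: "coprime a (int p)"
    by (metis coprime_mult_left_iff cong_imp_coprime cong_sym coprime_1_left)
  \<comment> \<open>Then R - 1 = d div 6, so 6 (x/d) (R - 1) <= x <= p as the kernel requires, while
    d <= 6 R loses only a constant.\<close>
  define R where "R = d div 6 + 1"
  have R: "R > 0" "R \<le> d" "d \<le> 6 * R" using d(1) by (auto simp: R_def)
  define s where "s = (\<Sum>r\<in>{1..<int R}. norm (?S (r * a)))"
  have s0: "s \<ge> 0" by (simp add: s_def sum_nonneg)
  have "real (card (int ` ?A)) * real R \<le> 4 * (real (card ?G) + 2 * s)"
    unfolding s_def
  proof (rule card_short_residues_le_exp_sums[OF p0 _ self_power_class_subset_unity_roots[OF p] R(1)])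
    fix g assume "g \<in> int ` ?A"
    then obtain x where x: "x \<in> ?A" "g = int x" by blast
    then have xd: "x = d * (x div d)" "x \<le> p" by (auto simp: self_power_class_def)
    have "[int (x div d) * (int d * a) = int (x div d) * 1] (mod int p)"
      using a by (rule cong_scalar_left)
    then have "[a * (int d * int (x div d)) = int (x div d)] (mod int p)"
      by (simp add: mult_ac)
    moreover have "int d * int (x div d) = g" using xd(1) x(2) by (metis of_nat_mult)
    ultimately have 1: "[int (x div d) = a * g] (mod int p)" by (simp add: cong_sym)
    have "6 * (x div d) * (d div 6) = (x div d) * (6 * (d div 6))" by simp
    also have "\<dots> \<le> (x div d) * d" by (intro mult_le_mono2) simp
    also have "\<dots> \<le> p" using xd by (metis mult.commute)
    finally have "int (6 * (x div d) * (d div 6)) \<le> int p" by (simp only: of_nat_le_iff)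
    then have "6 * int (x div d) * (int R - 1) \<le> int p" by (simp add: R_def zdiv_int)
    with 1 show "\<exists>y\<ge>0. [y = a * g] (mod int p) \<and> 6 * y * (int R - 1) \<le> int p"
      by (intro exI[of _ "int (x div d)"]) auto
  qed simp
  then have MR: "real (card ?A) * real R \<le> 4 * (real d + 2 * s)"
    by (simp add: cardG card_image)
  have M: "real (card ?A) \<le> 24 + 8 * (s / real R)"
  proof -
    have "real d \<le> 6 * real R" using R(3) by linarith
    then have "4 * (real d + 2 * s) \<le> 24 * real R + 8 * s" by simp
    with MR have "real (card ?A) * real R \<le> 24 * real R + 8 * s" by (rule order_trans)
    also have "\<dots> = (24 + 8 * (s / real R)) * real R"
      using R(1) by (simp add: field_simps)
    finally have "real (card ?A) * real R \<le> (24 + 8 * (s / real R)) * real R" .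
    then show ?thesis using R(1) by simp
  qed
  have count: "real (card {r \<in> {1..<int R}. [r ^ d = z] (mod int p)}) \<le> K" for z
  proof -
    let ?X = "{r \<in> {1..<R}. [int r ^ d = z] (mod int p)}"
    have eq: "{r \<in> {1..<int R}. [r ^ d = z] (mod int p)} = int ` ?X"
    proof
      show "{r \<in> {1..<int R}. [r ^ d = z] (mod int p)} \<subseteq> int ` ?X"
      proof
        fix r assume r: "r \<in> {r \<in> {1..<int R}. [r ^ d = z] (mod int p)}"
        then have "r = int (nat r)" by simp
        moreover have "nat r \<in> ?X" using r by auto
        ultimately show "r \<in> int ` ?X" by blast
      qed
    qed auto
    have sub: "?X \<subseteq> {1..d}" using R(2) by auto
    have "d * d * d \<le> p ^ 3" using d(2) by (simp add: power3_eq_cube mult_mono)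
    then have "card ?X * card ?X * card ?X \<le> T ^ 3 * (d * (d * d * d div p + 1))"
      by (intro card_prod3_coset_le[OF p d(1) sub sub sub, where ?z1.0 = z and ?z2.0 = z and ?z3.0 = z])
         (auto intro: T)
    then have "real (card ?X * card ?X * card ?X) \<le> real (T ^ 3 * (d * (d * d * d div p + 1)))"
      by (rule of_nat_mono)
    then have "real (card ?X) ^ 3 \<le> real (T ^ 3 * (d * (d * d * d div p + 1)))"
      by (simp only: of_nat_mult power3_eq_cube)
    also have "\<dots> = real T ^ 3 * (real d * (real (d ^ 3 div p) + 1))"
      by (simp add: power3_eq_cube algebra_simps)
    also have "\<dots> \<le> real T ^ 3 * (real d * (real d ^ 3 / real p + 1))"
      using of_nat_div_le_of_nat[of "d ^ 3" p] by (intro mult_left_mono add_right_mono) auto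
    also have "\<dots> \<le> K ^ 3" by (rule K(2))
    finally have "real (card ?X) \<le> K"
      using K(1) by (rule le_if_power_le) simp
    then show ?thesis unfolding eq by (simp add: card_image)
  qed
  define Q where "Q = (\<Sum>r\<in>{1..<int R}. norm (?S (r * a)) ^ 4)"
  define E where "E = real (energy_mod (int p) ?G)"
  have QE: "real d * Q \<le> K * (real p * E)"
  proof -
    have "real (card ?G) * Q \<le> K * (real_of_int (int p) * E)"
      unfolding Q_def E_def
    proof (rule exp_sum_fourth_moment_sparse[OF p' d(1) cop_a _ _ count])
      show "{1..<int R} \<subseteq> {0..<int p}" using R(2) d(2) by auto
      fix r assume r: "r \<in> {1..<int R}"
      then have "coprime (int (nat r)) (int p)" using R(2) d(2) by (intro cop_lt) auto
      then show "coprime r (int p)" using r by simp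
    qed
    then show ?thesis by (simp add: cardG)
  qed
  have s4: "s ^ 4 \<le> real R ^ 3 * Q"
  proof -
    have "s ^ 4 \<le> real (card {1..<int R}) ^ 3 * Q"
      unfolding s_def Q_def by (rule sum_fourth_power_le) simp
    also have "\<dots> \<le> real R ^ 3 * Q"
      by (intro mult_right_mono power_mono) (auto simp: Q_def sum_nonneg)
    finally show ?thesis .
  qed
  have Q0: "Q \<ge> 0" by (simp add: Q_def sum_nonneg)
  define D where "D = real d"
  define L where "L = 1 + ln (real p)"
  have D1: "D \<ge> 1" using d(1) by (simp add: D_def)
  have L1: "L \<ge> 1" using p1 by (simp add: L_def)
  \<comment> \<open>The diagonal term D^2 is absorbed into the main term, raising 358 to
    359.\<close>
  have E: "E \<le> 359 * (D ^ 2 * (D powr (1/2) * L))"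
  proof -
    have h: "D powr (3/2) = D * D powr (1/2)"
      using D1 powr_add[of D 1 "1/2"] by simp
    have 1: "1 \<le> D powr (1/2)" using D1 by (simp add: ge_one_powr_ge_zero)
    have "1 + ln D \<le> L" unfolding L_def D_def using d by simp
    moreover have "E \<le> D ^ 2 + D * (358 * (D powr (3/2) * (1 + ln D)))"
      unfolding E_def D_def by (rule energy_unity_roots_mod_le[OF p' d(1)]) (use dp in \<open>simp only: of_nat_le_iff\<close>)
    moreover have "D * (358 * (D powr (3/2) * (1 + ln D))) \<le> D * (358 * (D powr (3/2) * L))"
      using D1 calculation(1) by (intro mult_left_mono) auto
    moreover have "D ^ 2 * 1 \<le> D ^ 2 * (D powr (1/2) * L)"
      using mult_mono[OF 1 L1] by (intro mult_left_mono) auto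
    ultimately show ?thesis by (simp add: h power2_eq_square mult_ac)
  qed
  \<comment> \<open>From s^4 <= R^3 Q the average satisfies (s/R)^4 <= Q/R <= 6 Q/d. Together with d
    Q <= K p E the two factors 1/d cancel D^2 in the energy, and 6 * 359 = 2154.\<close>
  have "(s / real R) ^ 4 \<le> 2154 * (K * real p * D powr (1/2) * L)"
  proof -
    have "(s / real R) ^ 4 * real R = s ^ 4 / real R ^ 3"
      using R(1) by (simp add: power_divide field_simps eval_nat_numeral)
    also have "\<dots> \<le> Q" using s4 R(1) by (simp add: field_simps)
    finally have 1: "(s / real R) ^ 4 * real R \<le> Q" .
    have "D \<le> 6 * real R" unfolding D_def using R(3) by linarith
    then have "(s / real R) ^ 4 * D \<le> (s / real R) ^ 4 * (6 * real R)"
      by (intro mult_left_mono) auto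
    with 1 have "(s / real R) ^ 4 * D \<le> 6 * Q" by linarith
    then have "D * ((s / real R) ^ 4 * D) \<le> D * (6 * Q)" using D1 by (intro mult_left_mono) auto
    also have "\<dots> \<le> 6 * (K * (real p * E))" using QE by (simp add: D_def)
    also have "\<dots> \<le> 6 * (K * (real p * (359 * (D ^ 2 * (D powr (1/2) * L)))))"
      using K(1) E by (intro mult_left_mono) auto
    finally have "D ^ 2 * (s / real R) ^ 4 \<le> D ^ 2 * (2154 * (K * real p * D powr (1/2) * L))"
      by (simp add: power2_eq_square mult_ac)
    then show ?thesis using D1 by (simp only: mult_le_cancel_left_pos zero_less_power)
  qed
  then show ?thesis using that[OF _ M] s0 by (simp add: D_def L_def)
qed

text \<open>Two factors give M^2 <= p^o(1) (p/d + d), which is p^(54/82 + o(1)) as long as d lies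
  between p^(28/82) and p^(54/82). Three factors give M^3 <= p^o(1) ((p/d)^2 + d), enough up to
  p^(55/82), where p/d <= p^(27/82) takes over.\<close>

lemma card_self_power_class_bound:
  fixes \<eta> :: real
  assumes \<eta>: "\<eta> > 0"
  shows "\<exists>B\<ge>0. \<forall>p d. prime p \<longrightarrow> d dvd p - 1 \<longrightarrow>
    real (card (self_power_class p d)) \<le> B * real p powr (27/82 + \<eta>)"
proof -
  \<comment> \<open>Divisors are counted for integers up to p^3, costing p^(\<eta>/3), and the count
    enters cubed: the choice \<eta>/9 leaves p^\<eta> in total.\<close>
  obtain C where C1: "C \<ge> 1" and C: "\<And>n. n > 0 \<Longrightarrow> real (ndiv n) \<le> C * real n powr (\<eta> / 9)"
    using ndiv_bound[of "\<eta> / 9"] \<eta> by auto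
  \<comment> \<open>C^3 comes from the cube of the divisor bound, the factor 2 from bounding two
    summands by the same power of p.\<close>
  define C3 where "C3 = 2 * C ^ 3"
  define C4 where "C4 = 2154 * (C3 * (1 + 1 / \<eta>))"
  have C31: "C3 \<ge> 1" using one_le_power[OF C1, of 3] by (simp add: C3_def)
  have C41: "C4 \<ge> 1"
    using mult_mono[of 1 C3 1 "1 + 1 / \<eta>"] C31 \<eta> by (simp add: C4_def)
  \<comment> \<open>As C3 >= 1, replacing it by its n-th power is harmless; the same constant then
    survives the n-th root in every range.\<close>
  have const_power_mono: "C3 * x \<le> (C3 * y) ^ n" if "x \<le> y ^ n" "0 \<le> x" "n > 0" for x y :: real and n
  proof -
    have "C3 * x \<le> C3 ^ n * x"
      using C31 that power_increasing[of 1 n C3] by (intro mult_right_mono) auto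
    also have "\<dots> \<le> C3 ^ n * y ^ n" using C31 that by (intro mult_left_mono) auto
    finally show ?thesis by (simp add: power_mult_distrib)
  qed
  have main: "real (card (self_power_class p d)) \<le> (C3 + 24 + 8 * C4) * real p powr (27/82 + \<eta>)"
    if p: "prime p" and d: "d dvd p - 1" for p d
  proof -
    define P where "P = real p"
    define M where "M = real (card (self_power_class p d))"
    define N where "N = (p - 1) div d"
    define D where "D = real d"
    have p2: "p \<ge> 2" using p prime_ge_2_nat by blast
    have d0: "d > 0" using d p2 by (cases d) auto
    have "d \<le> p - 1" using d p2 by (auto dest: dvd_imp_le)
    then have dp: "d < p" using p2 by linarith
    have P2: "P \<ge> 2" and D1: "D \<ge> 1" using p2 d0 by (simp_all add: P_def D_def)
    have pw: "P powr x \<le> P powr y" if "x \<le> y" for x y using P2 that by (intro powr_mono) auto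
    have M0: "M \<ge> 0" by (simp add: M_def)
    have ND: "real N \<le> P / D"
    proof -
      have "real N \<le> real (p - 1) / real d" unfolding N_def by (rule of_nat_div_le_of_nat)
      also have "\<dots> \<le> P / D" using d0 by (simp add: P_def D_def divide_right_mono)
      finally show ?thesis .
    qed
    have Np: "N \<le> p" unfolding N_def using div_le_dividend[of "p - 1" d] by linarith
    obtain Y z where Y: "card Y = card (self_power_class p d)" "Y \<subseteq> {1..N}"
      "\<And>y. y \<in> Y \<Longrightarrow> [int y ^ d = z] (mod int p)"
      using self_power_class_quotients[OF p d0 dp] unfolding N_def by metis
    define T where "T = nat \<lfloor>C * P powr (\<eta> / 3)\<rfloor>"
    have T: "ndiv n \<le> T" if "1 \<le> n" "n \<le> p ^ 3" for n
    proof -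
      have "real (ndiv n) \<le> C * real n powr (\<eta> / 9)" using C that by simp
      also have "\<dots> \<le> C * (P ^ 3) powr (\<eta> / 9)"
        using that C1 \<eta> unfolding P_def
        by (intro mult_left_mono powr_mono2) (simp_all flip: of_nat_power)
      also have "(P ^ 3) powr (\<eta> / 9) = P powr (\<eta> / 3)"
        using P2 by (simp add: powr_powr flip: powr_numeral)
      finally show ?thesis unfolding T_def by (simp add: le_nat_floor)
    qed
    have T3: "real T ^ 3 \<le> C ^ 3 * P powr \<eta>"
    proof -
      have "real T \<le> C * P powr (\<eta> / 3)"
        unfolding T_def using C1 by (intro of_nat_floor) auto
      then have "real T ^ 3 \<le> (C * P powr (\<eta> / 3)) ^ 3" by (intro power_mono) auto
      also have "\<dots> = C ^ 3 * P powr \<eta>"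
        using P2 by (simp add: power_mult_distrib powr_power)
      finally show ?thesis .
    qed
    have T3_mult: "real T ^ 3 * (x + y) \<le> C3 * P powr (e + \<eta>)"
      if "x \<le> P powr e" "y \<le> P powr e" "0 \<le> x + y" for x y e
    proof -
      have "real T ^ 3 * (x + y) \<le> (C ^ 3 * P powr \<eta>) * (2 * P powr e)"
        using T3 that C1 by (intro mult_mono) auto
      then show ?thesis by (simp add: C3_def powr_add mult_ac)
    qed
    have prod_bound: "real (card Y) ^ k \<le> real T ^ 3 * (D * ((P / D) ^ k / P) + D)" if k: "k = 2 \<or> k = 3" for k
    proof -
      have "card Y ^ k \<le> T ^ 3 * (d * (N ^ k div p + 1))"
        using k
      proof
        assume k: "k = 2"
        \<comment> \<open>The singleton {1} as third set reduces the triple product estimate to two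
          factors.\<close>
        have "card Y * card Y * card {1 :: nat} \<le> T ^ 3 * (d * (N * N * 1 div p + 1))"
        proof (rule card_prod3_coset_le[OF p d0 Y(2,2) _ Y(3,3), where ?z3.0 = 1])
          fix n assume "1 \<le> n" "n \<le> N * N * 1"
          moreover have "N * N * 1 \<le> p * p * p" using Np p2 by (intro mult_le_mono) auto
          ultimately show "ndiv n \<le> T" by (intro T) (simp_all add: power3_eq_cube)
        qed auto
        then show ?thesis by (simp add: k power2_eq_square)
      next
        assume k: "k = 3"
        have "card Y * card Y * card Y \<le> T ^ 3 * (d * (N * N * N div p + 1))"
        proof (rule card_prod3_coset_le[OF p d0 Y(2,2,2) Y(3,3,3)])
          fix n assume "1 \<le> n" "n \<le> N * N * N"
          moreover have "N * N * N \<le> p * p * p" using Np by (intro mult_le_mono) auto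
          ultimately show "ndiv n \<le> T" by (intro T) (simp_all add: power3_eq_cube)
        qed
        then show ?thesis by (simp add: k power3_eq_cube)
      qed
      then have "real (card Y ^ k) \<le> real (T ^ 3 * (d * (N ^ k div p + 1)))" by (rule of_nat_mono)
      also have "\<dots> = real T ^ 3 * (D * (real (N ^ k div p) + 1))" by (simp add: D_def algebra_simps)
      also have "\<dots> \<le> real T ^ 3 * (D * ((P / D) ^ k / P + 1))"
      proof -
        have "real (N ^ k div p) \<le> real (N ^ k) / P" unfolding P_def by (rule of_nat_div_le_of_nat)
        also have "\<dots> \<le> (P / D) ^ k / P"
          using ND P2 by (simp add: divide_right_mono power_mono)
        finally show ?thesis using D1 by (intro mult_left_mono add_right_mono) auto
      qed
      finally show ?thesis by (simp add: distrib_left)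
    qed
    have div_le: "P / D \<le> P powr (1 - e)" if "P powr e \<le> D" for e
    proof -
      have "P / D \<le> P / P powr e" using that P2 D1 by (intro divide_left_mono) auto
      also have "\<dots> = P powr (1 - e)" using P2 by (simp add: powr_diff)
      finally show ?thesis .
    qed
    have weak: "M \<le> (C3 + 24 + 8 * C4) * P powr (27/82 + \<eta>)" if "M \<le> C3 * P powr (27/82 + \<eta>)"
      using that C41 C31 by (simp add: distrib_right add_increasing2 add_nonneg_nonneg)
    have weak1: "M \<le> (C3 + 24 + 8 * C4) * P powr (27/82 + \<eta>)" if "M \<le> P powr (27/82)"
    proof (rule weak)
      have "M \<le> 1 * P powr (27/82 + \<eta>)" using that pw[of "27/82" "27/82 + \<eta>"] \<eta> by simp
      also have "\<dots> \<le> C3 * P powr (27/82 + \<eta>)" using C31 by (intro mult_right_mono) auto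
      finally show "M \<le> C3 * P powr (27/82 + \<eta>)" .
    qed
    consider "D \<le> P powr (27/82)" | "P powr (55/82) \<le> D" | "P powr (28/82) \<le> D" "D \<le> P powr (54/82)"
      | "P powr (54/82) \<le> D" "D \<le> P powr (55/82)" | "P powr (27/82) \<le> D" "D \<le> P powr (28/82)"
      by linarith
    then have "M \<le> (C3 + 24 + 8 * C4) * P powr (27/82 + \<eta>)"
    proof cases
      case 1
      have "M \<le> D" using card_self_power_class_le[OF p d0] by (simp add: M_def D_def)
      with 1 show ?thesis by (intro weak1) simp
    next
      case 2
      have "card Y \<le> card {1..N}" using Y(2) by (intro card_mono) auto
      then have "M \<le> P / D" using Y(1) ND by (simp add: M_def)
      with div_le[OF 2] show ?thesis by (intro weak1) simp
    next
      case 3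
      have "M ^ 2 \<le> real T ^ 3 * (D * ((P / D) ^ 2 / P) + D)"
        using prod_bound[of 2] Y(1) by (simp add: M_def)
      also have "D * ((P / D) ^ 2 / P) = P / D"
        using P2 D1 by (simp add: power2_eq_square field_simps)
      also have "real T ^ 3 * (P / D + D) \<le> C3 * P powr (54/82 + \<eta>)"
        using 3 div_le[OF 3(1)] P2 D1 by (intro T3_mult) auto
      also have "\<dots> \<le> (C3 * P powr (27/82 + \<eta>)) ^ 2"
        using P2 \<eta> by (intro const_power_mono) (simp_all add: powr_power pw)
      finally have "M \<le> C3 * P powr (27/82 + \<eta>)"
        by (rule power2_le_imp_le) (use C31 in simp)
      then show ?thesis by (rule weak)
    next
      case 4
      have "M ^ 3 \<le> real T ^ 3 * (D * ((P / D) ^ 3 / P) + D)"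
        using prod_bound[of 3] Y(1) by (simp add: M_def)
      also have "D * ((P / D) ^ 3 / P) = (P / D) ^ 2"
        using P2 D1 by (simp add: power2_eq_square power3_eq_cube field_simps)
      also have "real T ^ 3 * ((P / D) ^ 2 + D) \<le> C3 * P powr (81/82 + \<eta>)"
      proof (rule T3_mult)
        have "(P / D) ^ 2 \<le> (P powr (1 - 54/82)) ^ 2"
          using div_le[OF 4(1)] P2 D1 by (intro power_mono) auto
        also have "\<dots> \<le> P powr (81/82)" using P2 by (simp add: powr_power pw)
        finally show "(P / D) ^ 2 \<le> P powr (81/82)" .
        show "D \<le> P powr (81/82)" using 4(2) pw[of "55/82" "81/82"] by simp
      qed (use D1 in simp)
      also have "\<dots> \<le> (C3 * P powr (27/82 + \<eta>)) ^ 3"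
        using P2 \<eta> by (intro const_power_mono) (simp_all add: powr_power pw)
      finally have "M \<le> C3 * P powr (27/82 + \<eta>)"
        by (rule le_if_power_le) (use C31 in simp_all)
      then show ?thesis by (rule weak)
    next
      case 5
      \<comment> \<open>K^3 has to dominate d^4/p <= p^(4 * 28/82 - 1) = p^(30/82) and also d <=
        p^(28/82), whence the exponent 10/82.\<close>
      define K where "K = C3 * P powr (10/82 + \<eta>)"
      have dd: "d * d \<le> p"
      proof -
        have "D * D \<le> P powr (28/82) * P powr (28/82)" using 5(2) D1 by (intro mult_mono) auto
        also have "\<dots> \<le> P powr 1" using pw[of "56/82" 1] by (simp flip: powr_add)
        finally have "real (d * d) \<le> real p" using P2 by (simp add: D_def P_def)
        then show ?thesis by (simp only: of_nat_le_iff)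
      qed
      have K: "real T ^ 3 * (real d * (real d ^ 3 / real p + 1)) \<le> K ^ 3"
      proof -
        have "real T ^ 3 * (real d * (real d ^ 3 / real p + 1)) = real T ^ 3 * (D ^ 4 / P + D)"
          by (simp add: D_def P_def distrib_left eval_nat_numeral)
        also have "\<dots> \<le> C3 * P powr (30/82 + \<eta>)"
        proof (rule T3_mult)
          have "D ^ 4 \<le> (P powr (28/82)) ^ 4" using 5(2) D1 by (intro power_mono) auto
          also have "\<dots> = P powr (30/82 + 1)" using P2 by (simp add: powr_power)
          also have "\<dots> = P powr (30/82) * P powr 1" by (rule powr_add)
          finally show "D ^ 4 / P \<le> P powr (30/82)" using P2 by (simp add: field_simps)
          show "D \<le> P powr (30/82)" using 5(2) pw[of "28/82" "30/82"] by simp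
        qed (use D1 P2 in simp)
        also have "\<dots> \<le> K ^ 3"
          unfolding K_def using P2 \<eta> by (intro const_power_mono) (simp_all add: powr_power pw)
        finally show ?thesis .
      qed
      have K0: "K \<ge> 0" using C31 by (simp add: K_def)
      obtain X where X: "X \<ge> 0" "M \<le> 24 + 8 * X"
        "X ^ 4 \<le> 2154 * (K * P * D powr (1/2) * (1 + ln P))"
        using card_self_power_class_fourier[OF p d0 dp dd T K0 K] unfolding M_def P_def D_def by metis
      have ln: "1 + ln P \<le> (1 + 1 / \<eta>) * P powr \<eta>"
      proof -
        have "1 \<le> P powr \<eta>" using P2 \<eta> by (simp add: ge_one_powr_ge_zero)
        moreover have "ln P \<le> P powr \<eta> / \<eta>" using P2 \<eta> by (intro ln_powr_bound) auto
        ultimately show ?thesis by (simp add: distrib_right)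
      qed
      have D2: "D powr (1/2) \<le> P powr (14/82)"
      proof -
        have "D powr (1/2) \<le> (P powr (28/82)) powr (1/2)" using 5(2) D1 by (intro powr_mono2) auto
        then show ?thesis by (simp add: powr_powr)
      qed
      have "X ^ 4 \<le> 2154 * (K * P * P powr (14/82) * ((1 + 1 / \<eta>) * P powr \<eta>))"
        by (rule order_trans[OF X(3)])
           (use K0 P2 D2 ln in \<open>intro mult_left_mono mult_mono, auto\<close>)
      also have "\<dots> = C4 * (P powr (10/82 + \<eta>) * P powr 1 * P powr (14/82) * P powr \<eta>)"
        using P2 by (simp add: C4_def K_def mult_ac)
      \<comment> \<open>Exponents in units of 1/82: 10 from K, 82 from p, 14 from the square root of
        d. The total 106 is below 4 * 27 = 108, and 2 \<eta> (from K and the logarithm) is below 4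
        \<eta>.\<close>
      also have "\<dots> = C4 * P powr (106/82 + 2 * \<eta>)"
        unfolding powr_add[symmetric] by (simp add: add.commute)
      also have "\<dots> \<le> C4 ^ 4 * (P powr (27/82 + \<eta>)) ^ 4"
      proof (rule mult_mono)
        show "C4 \<le> C4 ^ 4" using C41 power_increasing[of 1 4 C4] by simp
        show "P powr (106/82 + 2 * \<eta>) \<le> (P powr (27/82 + \<eta>)) ^ 4"
          using P2 \<eta> by (simp add: powr_power pw)
      qed (use C41 in auto)
      also have "\<dots> = (C4 * P powr (27/82 + \<eta>)) ^ 4" by (simp add: power_mult_distrib)
      finally have "X \<le> C4 * P powr (27/82 + \<eta>)"
        by (rule le_if_power_le) (use C41 in simp_all)
      then have "M \<le> 24 * 1 + 8 * (C4 * P powr (27/82 + \<eta>))" using X(2) by linarith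
      also have "\<dots> \<le> 24 * P powr (27/82 + \<eta>) + 8 * (C4 * P powr (27/82 + \<eta>))"
        using P2 \<eta> by (intro add_right_mono mult_left_mono ge_one_powr_ge_zero) auto
      also have "\<dots> \<le> (C3 + 24 + 8 * C4) * P powr (27/82 + \<eta>)"
        using C31 by (simp add: distrib_right)
      finally show ?thesis .
    qed
    then show ?thesis by (simp add: M_def P_def)
  qed
  show ?thesis
    using main C31 C41 by (intro exI[of _ "C3 + 24 + 8 * C4"]) auto
qed

theorem theorem1:
  shows "\<forall>\<epsilon>::real. \<epsilon> > 0 \<longrightarrow>
    (\<exists>c::real. c > 0 \<and>
      (\<forall>p::nat. prime p \<longrightarrow> real (J p 1) < c * real p powr (27 / 82 + \<epsilon>)))"
proof (intro allI impI)
  fix \<epsilon> :: real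
  assume \<epsilon>: "\<epsilon> > 0"
  \<comment> \<open>Half of \<epsilon> is spent on each class, the other half on the number of
    divisors of p - 1.\<close>
  obtain B where B: "B \<ge> 0" "\<And>p d. prime p \<Longrightarrow> d dvd p - 1 \<Longrightarrow>
      real (card (self_power_class p d)) \<le> B * real p powr (27/82 + \<epsilon> / 2)"
    using card_self_power_class_bound[of "\<epsilon> / 2"] \<epsilon> by auto
  obtain C where C: "C \<ge> 1" "\<And>n. n > 0 \<Longrightarrow> real (ndiv n) \<le> C * real n powr (\<epsilon> / 2)"
    using ndiv_bound[of "\<epsilon> / 2"] \<epsilon> by auto
  \<comment> \<open>Adding 1 to C B makes the inequality strict and the constant positive even if B
    = 0.\<close>
  have "real (J p 1) < (C * B + 1) * real p powr (27 / 82 + \<epsilon>)" if p: "prime p" for p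
  proof -
    have p2: "p \<ge> 2" using p prime_ge_2_nat by blast
    have "real (J p 1) \<le> real (\<Sum>d\<in>{d. d dvd p - 1}. card (self_power_class p d))"
      using J_1_le_sum_self_power_class[OF p] by (simp only: of_nat_le_iff)
    also have "\<dots> = (\<Sum>d\<in>{d. d dvd p - 1}. real (card (self_power_class p d)))" by simp
    also have "\<dots> \<le> (\<Sum>d\<in>{d. d dvd p - 1}. B * real p powr (27/82 + \<epsilon> / 2))"
      using B(2)[OF p] by (intro sum_mono) auto
    also have "\<dots> = real (ndiv (p - 1)) * (B * real p powr (27/82 + \<epsilon> / 2))"
      by (simp add: ndiv_def)
    also have "\<dots> \<le> (C * real p powr (\<epsilon> / 2)) * (B * real p powr (27/82 + \<epsilon> / 2))"
    proof (rule mult_right_mono)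
      have "real (ndiv (p - 1)) \<le> C * real (p - 1) powr (\<epsilon> / 2)" by (rule C(2)) (use p2 in simp)
      also have "\<dots> \<le> C * real p powr (\<epsilon> / 2)"
        using C(1) \<epsilon> by (intro mult_left_mono powr_mono2) auto
      finally show "real (ndiv (p - 1)) \<le> C * real p powr (\<epsilon> / 2)" .
    qed (use B(1) in simp)
    also have "\<dots> = C * B * (real p powr (\<epsilon> / 2) * real p powr (27/82 + \<epsilon> / 2))" by simp
    also have "\<dots> = C * B * real p powr (27/82 + \<epsilon>)"
      unfolding powr_add[symmetric] by (simp add: add.commute)
    also have "\<dots> < (C * B + 1) * real p powr (27 / 82 + \<epsilon>)"
      using p2 by (simp add: distrib_right)
    finally show ?thesis .
  qed
  moreover have "C * B + 1 > 0" using B(1) C(1) by (simp add: add_nonneg_pos)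
  ultimately show "\<exists>c>0. \<forall>p. prime p \<longrightarrow> real (J p 1) < c * real p powr (27 / 82 + \<epsilon>)"
    by blast
qed

end
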